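(* Let $\mu$ be a sampling-based inventory-agnostic policy with $|\Omega^\mu_{jt}|\le n+1$ for all $j\in\mathcal J$, $t\in\mathcal T$. Consider the following algorithm: for $t=1,\dots,T$ and $j=1,\dots,m$ in turn, choose $S^*\in\arg\max_{S\in\Omega^\mu_{jt}}\mathrm{rev}(M_{jt}(\mu,S))$ and redefine $\mu$ as $M_{jt}(\mu,S^* )$. The policy $\eta$ obtained at the end offers a deterministic sequence of assortments, each assortment $S^\eta_{jt}$ belongs to the support $\Omega_{jt}$ of the corresponding random assortment of the original policy, and $\mathrm{rev}(\eta)$ is at least the total expected revenue of the original policy. Moreover, the algorithm can be implemented in $O((mn+T)\,nT^2)$ operations.
   Context: Model. Products $\mathcal N=\{1,\dots,n\}$; product $i$ has revenue $r_i\ge 0$ and initial inventory $c_i\in\mathbb Z_+$, where one may take $c_i\le T$ since there is at most one unit of demand per period. Customer types $\mathcal J=\{1,\dots,m\}$; time periods $\mathcal T=\{1,\dots,T\}$. At each period $t$ exactly one customer arrives, of type $j$ with probability $\lambda_{jt}\ge0$, $\sum_{j\in\mathcal J}\lambda_{jt}=1$; arrivals and choices at different periods are independent. If assortment $S\subseteq\mathcal N$ is offered to a type-$j$ customer, she chooses product $i$ with probability $\phi_{ij}(S)\ge0$ and chooses nothing with probability $1-\sum_{i\in\mathcal N}\phi_{ij}(S)\ge 0$; $\phi_{ij}(S)=0$ for $i\notin S$. Substitutability: $\phi_{ij}(S\cup\{\ell\})\le\phi_{ij}(S)$ for all $i\in S$, $\ell\notin S$, $j\in\mathcal J$, $S\subseteq\mathcal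 N$. Policies. A sampling-based inventory-agnostic policy $\mu$ is given by mutually independent random assortments $(S^\mu_{jt}: j\in\mathcal J, t\in\mathcal T)$, independent of arrivals and choices; if a type-$j$ customer arrives at period $t$, the assortment $S^\mu_{jt}$ is offered regardless of remaining inventories. If the customer chooses a product with no remaining inventory she leaves without a purchase; otherwise, if she chooses product $i$, one unit of its inventory is consumed and revenue $r_i$ is collected. $\mathrm{rev}(\mu)$ is the total expected revenue of $\mu$ over the selling horizon. Explicitly, with $\varphi^\mu_{it}=\sum_{j}\lambda_{jt}\sum_{S}\mathbb P\{S^\mu_{jt}=S\}\phi_{ij}(S)$ and, for each $i$, independent Bernoulli random variables $B^\mu_{it}$ ($t\in\mathcal T$) with parameters $\varphi^\mu_{it}$, $\mathrm{rev}(\mu)=\sum_{i}r_i\,\mathbb E\{\min\{c_i,\sum_{t\in\mathcal T}B^\mu_{it}\}\}$. $\Omega^\mu_{jt}=\{S\subseteq\mathcal N:\mathbb P\{S^\mu_{jt}=S\}>0\}$ is the support of $S^\mu_{jt}$. $M_{jt}(\mu,S)$ denotes the policy obtained from $\mu$ by replacing $S^\mu_{jt}$ with the deterministic assortment $S$, keeping all else unchanged. Operations are counted in the unit-cost model: each arithmetic operation or comparison on reals, and each look-up of $r_i$, $c_i$, $\lambda_{jt}$, $\mathbb P\{S^\mu_{jt}=S\}$ or $\phi_{ij}(S)$ for $S$ in a support, costs $O(1)$. The policy $\mu$ is given by the list of its supports and probabilities. *)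

theory Defs
  imports "HOL-Probability.Probability"
begin

section \<open>The model\<close>

text \<open>
  Products are the numbers \<open>1..n\<close>, customer types \<open>1..m\<close>, periods \<open>1..T\<close>; the fields of a
  problem are only constrained, and only used, on these ranges. \<open>arrive P j t\<close> is \<open>\<lambda>\<^sub>j\<^sub>t\<close> and
  \<open>pick P i j S\<close> is \<open>\<phi>\<^sub>i\<^sub>j(S)\<close>.
\<close>

record problem =
  nprod :: nat
  ntype :: nat
  horizon :: nat
  revenue :: "nat \<Rightarrow> real"
  inventory :: "nat \<Rightarrow> nat"
  arrive :: "nat \<Rightarrow> nat \<Rightarrow> real"
  pick :: "nat \<Rightarrow> nat \<Rightarrow> nat set \<Rightarrow> real"

definition products :: "problem \<Rightarrow> nat set" where
  "products P = {1..nprod P}"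

definition ctypes :: "problem \<Rightarrow> nat set" where
  "ctypes P = {1..ntype P}"

definition periods :: "problem \<Rightarrow> nat set" where
  "periods P = {1..horizon P}"

definition valid_problem :: "problem \<Rightarrow> bool" where
  "valid_problem P \<longleftrightarrow>
     (\<forall>i\<in>products P. 0 \<le> revenue P i) \<and>
     (\<forall>j\<in>ctypes P. \<forall>t\<in>periods P. 0 \<le> arrive P j t) \<and>
     (\<forall>t\<in>periods P. (\<Sum>j\<in>ctypes P. arrive P j t) = 1) \<and>
     (\<forall>j\<in>ctypes P. \<forall>S. S \<subseteq> products P \<longrightarrow>
        (\<forall>i\<in>products P. 0 \<le> pick P i j S) \<and>
        (\<Sum>i\<in>products P. pick P i j S) \<le> 1 \<and>
        (\<forall>i\<in>products P. i \<notin> S \<longrightarrow> pick P i j S = 0) \<and>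
        (\<forall>l\<in>products P. l \<notin> S \<longrightarrow> (\<forall>i\<in>S. pick P i j (insert l S) \<le> pick P i j S)))"

text \<open>
  The random assortments of a policy are mutually independent, so a policy is determined by the
  law of each \<open>S\<^sub>j\<^sub>t\<close>; the support of \<open>S\<^sub>j\<^sub>t\<close> is \<open>set_pmf (\<mu> j t)\<close>.
\<close>

type_synonym policy = "nat \<Rightarrow> nat \<Rightarrow> nat set pmf"

definition valid_policy :: "problem \<Rightarrow> policy \<Rightarrow> bool" where
  "valid_policy P \<mu> \<longleftrightarrow>
     (\<forall>j\<in>ctypes P. \<forall>t\<in>periods P. set_pmf (\<mu> j t) \<subseteq> Pow (products P))"

definition replace :: "nat \<Rightarrow> nat \<Rightarrow> policy \<Rightarrow> nat set \<Rightarrow> policy" where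
  "replace j t \<mu> S = \<mu>(j := (\<mu> j)(t := return_pmf S))"

subsection \<open>Expected revenue\<close>

definition arrival_pmf :: "problem \<Rightarrow> nat \<Rightarrow> nat pmf" where
  "arrival_pmf P t = embed_pmf (\<lambda>j. if j \<in> ctypes P then arrive P j t else 0)"

text \<open>\<open>None\<close> is the no-purchase option.\<close>

definition choice_pmf :: "problem \<Rightarrow> nat \<Rightarrow> nat set \<Rightarrow> nat option pmf" where
  "choice_pmf P j S = embed_pmf (\<lambda>x. case x of
      None \<Rightarrow> 1 - (\<Sum>i\<in>products P. pick P i j S)
    | Some i \<Rightarrow> if i \<in> products P then pick P i j S else 0)"

text \<open>
  Joint law of the choices made in periods \<open>1..T\<close>: \<open>J t\<close> is the type arriving in period \<open>t\<close> and
  \<open>A (j, t)\<close> the realisation of \<open>S\<^sub>j\<^sub>t\<close>. Remaining inventories play no role here.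
\<close>

definition choices_pmf :: "problem \<Rightarrow> policy \<Rightarrow> (nat \<Rightarrow> nat option) pmf" where
  "choices_pmf P \<mu> =
     bind_pmf (Pi_pmf (periods P) 0 (arrival_pmf P)) (\<lambda>J.
     bind_pmf (Pi_pmf (ctypes P \<times> periods P) {} (\<lambda>(j, t). \<mu> j t)) (\<lambda>A.
     Pi_pmf (periods P) None (\<lambda>t. choice_pmf P (J t) (A (J t, t)))))"

text \<open>\<open>stock P w t i\<close> is the inventory of \<open>i\<close> after period \<open>t\<close> along the choice sequence \<open>w\<close>.\<close>

primrec stock :: "problem \<Rightarrow> (nat \<Rightarrow> nat option) \<Rightarrow> nat \<Rightarrow> nat \<Rightarrow> nat" where
  "stock P w 0 i = inventory P i"
| "stock P w (Suc t) i =
     (if w (Suc t) = Some i \<and> 0 < stock P w t i then stock P w t i - 1 else stock P w t i)"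

definition sale_revenue :: "problem \<Rightarrow> (nat \<Rightarrow> nat option) \<Rightarrow> nat \<Rightarrow> real" where
  "sale_revenue P w t = (case w t of
      None \<Rightarrow> 0
    | Some i \<Rightarrow> if 0 < stock P w (t - 1) i then revenue P i else 0)"

definition exp_revenue :: "problem \<Rightarrow> policy \<Rightarrow> real" where
  "exp_revenue P \<mu> =
     measure_pmf.expectation (choices_pmf P \<mu>) (\<lambda>w. \<Sum>t\<in>periods P. sale_revenue P w t)"

text \<open>
  Not needed below: with \<open>offer_prob P \<mu> i t\<close> for \<open>\<phi>\<^sup>\<mu>\<^sub>i\<^sub>t\<close>, the expected revenue of the sales process is
  \<open>\<Sum>\<^sub>i r\<^sub>i E min {c\<^sub>i, \<Sum>\<^sub>t B\<^sub>i\<^sub>t}\<close> with independent Bernoulli \<open>B\<^sub>i\<^sub>t\<close> (\<open>exp_revenue_formula\<close>).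
\<close>

lemma finite_idx [simp]: "finite (products P)" "finite (ctypes P)" "finite (periods P)"
  by (simp_all add: products_def ctypes_def periods_def)

lemma Pi_pmf_section:
  assumes C: "finite C" and T: "finite T" and J: "\<And>t. t \<in> T \<Longrightarrow> J t \<in> C"
  shows "map_pmf (\<lambda>A t. if t \<in> T then A (J t, t) else d) (Pi_pmf (C \<times> T) d p) =
         Pi_pmf T d (\<lambda>t. p (J t, t))" (is "?L = ?R")
proof (rule pmf_eqI)
  fix f
  show "pmf ?L f = pmf ?R f"
  proof (cases "\<forall>t. t \<notin> T \<longrightarrow> f t = d")
    case False
    then have "pmf ?R f = 0" using T by (auto simp: pmf_Pi)
    moreover have "f \<notin> set_pmf ?L" using False by (auto simp: fun_eq_iff)
    ultimately show ?thesis unfolding set_pmf_iff by simp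
  next
    case True
    let ?B = "\<lambda>x. if fst x = J (snd x) then {f (snd x)} else UNIV"
    have "pmf ?L f = measure_pmf.prob (Pi_pmf (C \<times> T) d p)
        ((\<lambda>A t. if t \<in> T then A (J t, t) else d) -` {f})"
      by (simp add: pmf_map)
    also have "(\<lambda>A t. if t \<in> T then A (J t, t) else d) -` {f} = Pi (C \<times> T) ?B"
      using True J by (auto simp: fun_eq_iff Pi_def)
    also have "measure_pmf.prob (Pi_pmf (C \<times> T) d p) \<dots>
        = (\<Prod>x\<in>C \<times> T. measure_pmf.prob (p x) (?B x))"
      using C T by (intro measure_Pi_pmf_Pi) auto
    also have "\<dots> = (\<Prod>j\<in>C. \<Prod>t\<in>T. if j = J t then pmf (p (J t, t)) (f t) else 1)"
      unfolding prod.cartesian_product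
      by (intro prod.cong) (auto simp: measure_pmf_single)
    also have "\<dots> = (\<Prod>t\<in>T. \<Prod>j\<in>C. if j = J t then pmf (p (J t, t)) (f t) else 1)"
      by (rule prod.swap)
    also have "\<dots> = (\<Prod>t\<in>T. pmf (p (J t, t)) (f t))"
      using C J by (intro prod.cong) auto
    also have "\<dots> = pmf ?R f" using T True by (subst pmf_Pi) auto
    finally show ?thesis .
  qed
qed

lemma pmf_arrival:
  assumes "valid_problem P" "t \<in> periods P"
  shows "pmf (arrival_pmf P t) j = (if j \<in> ctypes P then arrive P j t else 0)"
  unfolding arrival_pmf_def
proof (rule pmf_embed_pmf)
  show "0 \<le> (if x \<in> ctypes P then arrive P x t else 0)" for x
    using assms by (auto simp: valid_problem_def)
  have "(\<integral>\<^sup>+x. ennreal (if x \<in> ctypes P then arrive P x t else 0) \<partial>count_space UNIV)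
      = (\<Sum>x\<in>ctypes P. ennreal (if x \<in> ctypes P then arrive P x t else 0))"
    by (rule nn_integral_count_space') auto
  also have "\<dots> = ennreal (\<Sum>x\<in>ctypes P. if x \<in> ctypes P then arrive P x t else 0)"
    using assms by (intro sum_ennreal) (auto simp: valid_problem_def)
  also have "(\<Sum>x\<in>ctypes P. if x \<in> ctypes P then arrive P x t else 0) = 1"
    using assms by (simp add: valid_problem_def)
  finally show "(\<integral>\<^sup>+x. ennreal (if x \<in> ctypes P then arrive P x t else 0)
      \<partial>count_space UNIV) = 1" by simp
qed

lemma pmf_choice:
  assumes "valid_problem P" "j \<in> ctypes P" "S \<subseteq> products P"
  shows "pmf (choice_pmf P j S) (Some i) = (if i \<in> products P then pick P i j S else 0)"
proof -
  let ?f = "\<lambda>x. case x of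
      None \<Rightarrow> 1 - (\<Sum>i\<in>products P. pick P i j S)
    | Some i \<Rightarrow> if i \<in> products P then pick P i j S else 0"
  have nn: "0 \<le> pick P i j S" if "i \<in> products P" for i
    using assms that by (auto simp: valid_problem_def)
  have le: "(\<Sum>i\<in>products P. pick P i j S) \<le> 1"
    using assms by (auto simp: valid_problem_def)
  have "(\<integral>\<^sup>+x. ennreal (?f x) \<partial>count_space UNIV)
      = (\<Sum>x\<in>insert None (Some ` products P). ennreal (?f x))"
    by (rule nn_integral_count_space') (auto split: option.splits)
  also have "\<dots> = ennreal (\<Sum>x\<in>insert None (Some ` products P). ?f x)"
    using nn le by (intro sum_ennreal) (auto split: option.splits)
  also have "(\<Sum>x\<in>insert None (Some ` products P). ?f x) = 1"
    by (subst sum.insert) (auto simp: sum.reindex)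
  finally have "(\<integral>\<^sup>+x. ennreal (?f x) \<partial>count_space UNIV) = 1" by simp
  then have "pmf (choice_pmf P j S) (Some i) = ?f (Some i)"
    unfolding choice_pmf_def using nn le
    by (intro pmf_embed_pmf) (auto split: option.splits)
  then show ?thesis by simp
qed

lemma set_arrival:
  assumes "valid_problem P" "t \<in> periods P"
  shows "set_pmf (arrival_pmf P t) \<subseteq> ctypes P"
  using pmf_arrival[OF assms] by (auto simp: set_pmf_iff split: if_splits)

lemma choices_pmf_eq:
  assumes V: "valid_problem P"
  shows "choices_pmf P \<mu> = Pi_pmf (periods P) None (\<lambda>t.
     bind_pmf (arrival_pmf P t) (\<lambda>j. bind_pmf (\<mu> j t) (choice_pmf P j)))"
proof -
  let ?T = "periods P"
  have "choices_pmf P \<mu> = bind_pmf (Pi_pmf ?T 0 (arrival_pmf P)) (\<lambda>J.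
     Pi_pmf ?T None (\<lambda>t. bind_pmf (\<mu> (J t) t) (choice_pmf P (J t))))"
    unfolding choices_pmf_def
  proof (rule bind_pmf_cong)
    fix J assume "J \<in> set_pmf (Pi_pmf ?T 0 (arrival_pmf P))"
    then have J: "J t \<in> ctypes P" if "t \<in> ?T" for t
      using that set_Pi_pmf_subset'[of ?T 0 "arrival_pmf P"] set_arrival[OF V]
      by (fastforce simp: PiE_dflt_def)
    have "Pi_pmf ?T None (\<lambda>t. bind_pmf (\<mu> (J t) t) (choice_pmf P (J t))) =
       bind_pmf (Pi_pmf ?T {} (\<lambda>t. \<mu> (J t) t)) (\<lambda>A. Pi_pmf ?T None (\<lambda>t. choice_pmf P (J t) (A t)))"
      by (rule Pi_pmf_bind) simp
    also have "Pi_pmf ?T {} (\<lambda>t. \<mu> (J t) t) =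
       map_pmf (\<lambda>A t. if t \<in> ?T then A (J t, t) else {})
         (Pi_pmf (ctypes P \<times> ?T) {} (\<lambda>(j, t). \<mu> j t))"
      by (subst Pi_pmf_section) (auto simp: J)
    finally show "bind_pmf (Pi_pmf (ctypes P \<times> ?T) {} (\<lambda>(j, t). \<mu> j t)) (\<lambda>A.
        Pi_pmf ?T None (\<lambda>t. choice_pmf P (J t) (A (J t, t)))) =
        Pi_pmf ?T None (\<lambda>t. bind_pmf (\<mu> (J t) t) (choice_pmf P (J t)))"
      by (auto simp: bind_map_pmf intro!: bind_pmf_cong Pi_pmf_cong)
  qed simp
  also have "\<dots> = Pi_pmf ?T None (\<lambda>t.
     bind_pmf (arrival_pmf P t) (\<lambda>j. bind_pmf (\<mu> j t) (choice_pmf P j)))"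
    by (rule Pi_pmf_bind[symmetric]) simp
  finally show ?thesis .
qed

lemma stock_eq:
  "stock P w t i = inventory P i - card {s\<in>{1..t}. w s = Some i}"
proof (induction t)
  case (Suc t)
  have "{s\<in>{1..Suc t}. w s = Some i} =
     (if w (Suc t) = Some i then insert (Suc t) {s\<in>{1..t}. w s = Some i}
      else {s\<in>{1..t}. w s = Some i})"
    by (auto simp: le_Suc_eq)
  then have "card {s\<in>{1..Suc t}. w s = Some i} =
     card {s\<in>{1..t}. w s = Some i} + (if w (Suc t) = Some i then 1 else 0)"
    by simp
  then show ?case using Suc by simp
qed simp

lemma total_sales:
  assumes "\<And>t i. w t = Some i \<Longrightarrow> i \<in> products P"
  shows "(\<Sum>t\<in>{1..h}. sale_revenue P w t) =
    (\<Sum>i\<in>products P. revenue P i * real (min (inventory P i) (card {t\<in>{1..h}. w t = Some i})))"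
proof (induction h)
  case (Suc h)
  have c: "card {s\<in>{1..Suc h}. w s = Some i} =
     card {s\<in>{1..h}. w s = Some i} + (if w (Suc h) = Some i then 1 else 0)" for i
  proof -
    have "{s\<in>{1..Suc h}. w s = Some i} =
     (if w (Suc h) = Some i then insert (Suc h) {s\<in>{1..h}. w s = Some i}
      else {s\<in>{1..h}. w s = Some i})"
      by (auto simp: le_Suc_eq)
    then show ?thesis by simp
  qed
  have "(\<Sum>i\<in>products P. revenue P i *
      real (min (inventory P i) (card {t\<in>{1..Suc h}. w t = Some i}))) =
    (\<Sum>i\<in>products P. revenue P i *
      real (min (inventory P i) (card {t\<in>{1..h}. w t = Some i})) +
      (if w (Suc h) = Some i then if 0 < stock P w h i then revenue P i else 0 else 0))"
  proof (intro sum.cong refl)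
    fix i
    let ?c = "card {s\<in>{1..h}. w s = Some i}"
    have "real (min (inventory P i) (?c + 1)) =
        real (min (inventory P i) ?c) + (if 0 < inventory P i - ?c then 1 else 0)"
      by (cases "?c < inventory P i") (simp_all add: min_def)
    then show "revenue P i * real (min (inventory P i) (card {t\<in>{1..Suc h}. w t = Some i})) =
      revenue P i * real (min (inventory P i) ?c) +
      (if w (Suc h) = Some i then if 0 < stock P w h i then revenue P i else 0 else 0)"
      unfolding c stock_eq by (simp add: algebra_simps)
  qed
  also have "\<dots> = (\<Sum>i\<in>products P. revenue P i *
      real (min (inventory P i) (card {t\<in>{1..h}. w t = Some i}))) + sale_revenue P w (Suc h)"
    using assms[of "Suc h"]
    by (auto simp: sum.distrib sale_revenue_def split: option.splits)
  finally show ?case using Suc by simp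
qed simp

definition offer_prob :: "problem \<Rightarrow> policy \<Rightarrow> nat \<Rightarrow> nat \<Rightarrow> real" where
  "offer_prob P \<mu> i t = (\<Sum>j\<in>ctypes P. arrive P j t *
     (\<Sum>S\<in>Pow (products P). pmf (\<mu> j t) S * pick P i j S))"

lemma pmf_period:
  assumes V: "valid_problem P" "valid_policy P \<mu>" and t: "t \<in> periods P" and i: "i \<in> products P"
  shows "pmf (bind_pmf (arrival_pmf P t) (\<lambda>j. bind_pmf (\<mu> j t) (choice_pmf P j))) (Some i)
     = offer_prob P \<mu> i t"
proof -
  have "pmf (bind_pmf (arrival_pmf P t) (\<lambda>j. bind_pmf (\<mu> j t) (choice_pmf P j))) (Some i) =
    (\<Sum>j\<in>ctypes P. pmf (arrival_pmf P t) j * pmf (bind_pmf (\<mu> j t) (choice_pmf P j)) (Some i))"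
    unfolding pmf_bind using set_arrival[OF V(1) t]
    by (subst integral_measure_pmf_real[of "ctypes P"]) (auto simp: mult.commute)
  also have "\<dots> = offer_prob P \<mu> i t"
    unfolding offer_prob_def
  proof (intro sum.cong refl arg_cong2[where f = "(*)"])
    fix j assume j: "j \<in> ctypes P"
    show "pmf (arrival_pmf P t) j = arrive P j t" using j pmf_arrival[OF V(1) t] by simp
    have S: "set_pmf (\<mu> j t) \<subseteq> Pow (products P)"
      using V(2) j t by (auto simp: valid_policy_def)
    have "pmf (bind_pmf (\<mu> j t) (choice_pmf P j)) (Some i) =
      (\<Sum>S\<in>Pow (products P). pmf (\<mu> j t) S * pmf (choice_pmf P j S) (Some i))"
      unfolding pmf_bind using S
      by (subst integral_measure_pmf_real[of "Pow (products P)"]) (auto simp: mult.commute)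
    also have "\<dots> = (\<Sum>S\<in>Pow (products P). pmf (\<mu> j t) S * pick P i j S)"
      using i j by (intro sum.cong) (auto simp: pmf_choice[OF V(1)])
    finally show "pmf (bind_pmf (\<mu> j t) (choice_pmf P j)) (Some i) =
      (\<Sum>S\<in>Pow (products P). pmf (\<mu> j t) S * pick P i j S)" .
  qed
  finally show ?thesis .
qed

theorem exp_revenue_formula:
  assumes V: "valid_problem P" "valid_policy P \<mu>"
  shows "exp_revenue P \<mu> = (\<Sum>i\<in>products P. revenue P i *
    measure_pmf.expectation
      (Pi_pmf (periods P) False (\<lambda>t. bernoulli_pmf (offer_prob P \<mu> i t)))
      (\<lambda>B. real (min (inventory P i) (card {t\<in>periods P. B t}))))"
proof -
  let ?T = "periods P"
  let ?q = "\<lambda>t. bind_pmf (arrival_pmf P t) (\<lambda>j. bind_pmf (\<mu> j t) (choice_pmf P j))"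
  let ?W = "Pi_pmf ?T None ?q"
  let ?g = "\<lambda>i w. real (min (inventory P i) (card {t\<in>?T. w t = Some i}))"
  have supp: "i \<in> products P" if w: "w \<in> set_pmf ?W" and e: "w t = Some i" for w t i
  proof -
    have t: "t \<in> ?T" and "Some i \<in> set_pmf (?q t)"
      using w e set_Pi_pmf_subset'[of ?T None ?q]
      by (cases "t \<in> ?T"; force simp: PiE_dflt_def)+
    then obtain j S where "j \<in> set_pmf (arrival_pmf P t)" "S \<in> set_pmf (\<mu> j t)"
      "Some i \<in> set_pmf (choice_pmf P j S)"
      by auto
    moreover from this have "j \<in> ctypes P" using set_arrival[OF V(1) t] by auto
    moreover from this have "S \<subseteq> products P"
      using V(2) t \<open>S \<in> set_pmf (\<mu> j t)\<close> by (auto simp: valid_policy_def)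
    ultimately show ?thesis
      using pmf_choice[OF V(1), of j S i] by (auto simp: set_pmf_iff split: if_splits)
  qed
  have bnd: "integrable (measure_pmf ?W) (?g i)" for i
    by (rule measure_pmf.integrable_const_bound[where B = "real (inventory P i)"]) auto
  have "exp_revenue P \<mu> = measure_pmf.expectation ?W (\<lambda>w. \<Sum>i\<in>products P. revenue P i * ?g i w)"
    unfolding exp_revenue_def choices_pmf_eq[OF V(1)]
    using supp total_sales[of _ P "horizon P"]
    by (intro integral_cong_AE) (auto simp: AE_measure_pmf_iff periods_def)
  also have "\<dots> = (\<Sum>i\<in>products P. revenue P i * measure_pmf.expectation ?W (?g i))"
    using bnd by (subst Bochner_Integration.integral_sum) auto
  also have "\<dots> = (\<Sum>i\<in>products P. revenue P i *
    measure_pmf.expectation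
      (Pi_pmf ?T False (\<lambda>t. bernoulli_pmf (offer_prob P \<mu> i t)))
      (\<lambda>B. real (min (inventory P i) (card {t\<in>?T. B t}))))"
  proof (intro sum.cong refl arg_cong2[where f = "(*)"])
    fix i assume i: "i \<in> products P"
    have "map_pmf (\<lambda>x. x = Some i) (?q t) = bernoulli_pmf (offer_prob P \<mu> i t)"
      if t: "t \<in> ?T" for t
    proof -
      have p: "pmf (map_pmf (\<lambda>x. x = Some i) (?q t)) True = offer_prob P \<mu> i t"
        using pmf_period[OF V t i]
        by (simp add: pmf_map vimage_def measure_pmf_single)
      then have r: "0 \<le> offer_prob P \<mu> i t" "offer_prob P \<mu> i t \<le> 1"
        using pmf_nonneg pmf_le_1 by metis+
      show ?thesis
        by (rule pmf_eqI) (metis (full_types) p r pmf_bernoulli_True pmf_False_conv_True)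
    qed
    then have "Pi_pmf ?T False (\<lambda>t. bernoulli_pmf (offer_prob P \<mu> i t)) =
      Pi_pmf ?T False (\<lambda>t. map_pmf (\<lambda>x. x = Some i) (?q t))"
      by (intro Pi_pmf_cong) auto
    also have "\<dots> = map_pmf (\<lambda>h. (\<lambda>x. x = Some i) \<circ> h) ?W"
      by (rule Pi_pmf_map) auto
    finally show "measure_pmf.expectation ?W (?g i) = measure_pmf.expectation
      (Pi_pmf ?T False (\<lambda>t. bernoulli_pmf (offer_prob P \<mu> i t)))
      (\<lambda>B. real (min (inventory P i) (card {t\<in>?T. B t})))"
      by simp
  qed
  finally show ?thesis .
qed

subsection \<open>The greedy derandomization\<close>

text \<open>
  A relation rather than a function, because the maximizer need not be unique:
  \<open>greedy_steps P ps \<mu> \<eta>\<close> holds if some resolution of the ties leads from \<open>\<mu>\<close> to \<open>\<eta>\<close> when the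
  pairs \<open>(j, t)\<close> are treated in the order of \<open>ps\<close>.
\<close>

primrec greedy_steps :: "problem \<Rightarrow> (nat \<times> nat) list \<Rightarrow> policy \<Rightarrow> policy \<Rightarrow> bool" where
  "greedy_steps P [] \<mu> \<eta> \<longleftrightarrow> \<eta> = \<mu>"
| "greedy_steps P (p # ps) \<mu> \<eta> \<longleftrightarrow> (case p of (j, t) \<Rightarrow>
     \<exists>S. is_arg_max (\<lambda>S. exp_revenue P (replace j t \<mu> S)) (\<lambda>S. S \<in> set_pmf (\<mu> j t)) S \<and>
         greedy_steps P ps (replace j t \<mu> S) \<eta>)"

definition greedy :: "problem \<Rightarrow> policy \<Rightarrow> policy \<Rightarrow> bool" where
  "greedy P \<mu> \<eta> \<longleftrightarrow>
     greedy_steps P [(j, t). t \<leftarrow> [1..<Suc (horizon P)], j \<leftarrow> [1..<Suc (ntype P)]] \<mu> \<eta>"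


section \<open>The unit-cost model\<close>

text \<open>
  While-programs over index registers, real registers and two-dimensional arrays of either kind.
  Real numbers are available only through the arithmetic operations, comparisons and the look-ups;
  there is no conversion between reals and indices. All index computations, memory accesses,
  assignments and tests are charged as well, so the cost bounds the number of operations on reals
  and of look-ups from above.

  The policy is given by enumerations \<open>\<Omega> j t\<close> of its supports: an assortment is referred to by
  its position \<open>k\<close>, counted from 0, in \<open>\<Omega> j t\<close>.
\<close>

datatype iexp =
    ICon nat
  | IReg string
  | IArr string iexp iexp
  | IAdd iexp iexp
  | ISub iexp iexp
  | IProducts
  | ITypes
  | IPeriods
  | IInventory iexp
  | ISupportSize iexp iexp

datatype rexp =
    RCon nat
  | RReg string
  | RArr string iexp iexp
  | RAdd rexp rexp
  | RSub rexp rexp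
  | RMul rexp rexp
  | RDiv rexp rexp
  | RRevenue iexp
  | RArrive iexp iexp
  | RProb iexp iexp iexp
  | RPick iexp iexp iexp iexp

datatype bexp =
    BIndexLess iexp iexp
  | BRealLess rexp rexp
  | BNot bexp
  | BAnd bexp bexp

datatype com =
    Skip
  | SetIReg string iexp
  | SetIArr string iexp iexp iexp
  | SetRReg string rexp
  | SetRArr string iexp iexp rexp
  | Seq com com
  | Cond bexp com com
  | While bexp com

record state =
  ireg :: "string \<Rightarrow> nat"
  iarr :: "string \<Rightarrow> nat \<Rightarrow> nat \<Rightarrow> nat"
  rreg :: "string \<Rightarrow> real"
  rarr :: "string \<Rightarrow> nat \<Rightarrow> nat \<Rightarrow> real"

definition init_state :: state where
  "init_state =
     \<lparr>ireg = (\<lambda>_. 0), iarr = (\<lambda>_ _ _. 0), rreg = (\<lambda>_. 0), rarr = (\<lambda>_ _ _. 0)\<rparr>"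

type_synonym supports = "nat \<Rightarrow> nat \<Rightarrow> nat set list"

definition enumerates :: "problem \<Rightarrow> policy \<Rightarrow> supports \<Rightarrow> bool" where
  "enumerates P \<mu> \<Omega> \<longleftrightarrow>
     (\<forall>j\<in>ctypes P. \<forall>t\<in>periods P. distinct (\<Omega> j t) \<and> set (\<Omega> j t) = set_pmf (\<mu> j t))"

text \<open>Look-ups outside the ranges of the input return 0. Index subtraction is truncated at 0.\<close>

primrec ival :: "problem \<Rightarrow> supports \<Rightarrow> state \<Rightarrow> iexp \<Rightarrow> nat" where
  "ival P \<Omega> s (ICon c) = c"
| "ival P \<Omega> s (IReg x) = ireg s x"
| "ival P \<Omega> s (IArr x a b) = iarr s x (ival P \<Omega> s a) (ival P \<Omega> s b)"
| "ival P \<Omega> s (IAdd a b) = ival P \<Omega> s a + ival P \<Omega> s b"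
| "ival P \<Omega> s (ISub a b) = ival P \<Omega> s a - ival P \<Omega> s b"
| "ival P \<Omega> s IProducts = nprod P"
| "ival P \<Omega> s ITypes = ntype P"
| "ival P \<Omega> s IPeriods = horizon P"
| "ival P \<Omega> s (IInventory a) =
     (let i = ival P \<Omega> s a in if i \<in> products P then inventory P i else 0)"
| "ival P \<Omega> s (ISupportSize a b) =
     (let j = ival P \<Omega> s a; t = ival P \<Omega> s b in
      if j \<in> ctypes P \<and> t \<in> periods P then length (\<Omega> j t) else 0)"

primrec rval :: "problem \<Rightarrow> policy \<Rightarrow> supports \<Rightarrow> state \<Rightarrow> rexp \<Rightarrow> real" where
  "rval P \<mu> \<Omega> s (RCon c) = real c"
| "rval P \<mu> \<Omega> s (RReg x) = rreg s x"
| "rval P \<mu> \<Omega> s (RArr x a b) = rarr s x (ival P \<Omega> s a) (ival P \<Omega> s b)"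
| "rval P \<mu> \<Omega> s (RAdd a b) = rval P \<mu> \<Omega> s a + rval P \<mu> \<Omega> s b"
| "rval P \<mu> \<Omega> s (RSub a b) = rval P \<mu> \<Omega> s a - rval P \<mu> \<Omega> s b"
| "rval P \<mu> \<Omega> s (RMul a b) = rval P \<mu> \<Omega> s a * rval P \<mu> \<Omega> s b"
| "rval P \<mu> \<Omega> s (RDiv a b) = rval P \<mu> \<Omega> s a / rval P \<mu> \<Omega> s b"
| "rval P \<mu> \<Omega> s (RRevenue a) =
     (let i = ival P \<Omega> s a in if i \<in> products P then revenue P i else 0)"
| "rval P \<mu> \<Omega> s (RArrive a b) =
     (let j = ival P \<Omega> s a; t = ival P \<Omega> s b in
      if j \<in> ctypes P \<and> t \<in> periods P then arrive P j t else 0)"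
| "rval P \<mu> \<Omega> s (RProb a b c) =
     (let j = ival P \<Omega> s a; t = ival P \<Omega> s b; k = ival P \<Omega> s c in
      if j \<in> ctypes P \<and> t \<in> periods P \<and> k < length (\<Omega> j t)
      then pmf (\<mu> j t) (\<Omega> j t ! k) else 0)"
| "rval P \<mu> \<Omega> s (RPick d a b c) =
     (let i = ival P \<Omega> s d; j = ival P \<Omega> s a; t = ival P \<Omega> s b; k = ival P \<Omega> s c in
      if i \<in> products P \<and> j \<in> ctypes P \<and> t \<in> periods P \<and> k < length (\<Omega> j t)
      then pick P i j (\<Omega> j t ! k) else 0)"

primrec bval :: "problem \<Rightarrow> policy \<Rightarrow> supports \<Rightarrow> state \<Rightarrow> bexp \<Rightarrow> bool" where
  "bval P \<mu> \<Omega> s (BIndexLess a b) \<longleftrightarrow> ival P \<Omega> s a < ival P \<Omega> s b"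
| "bval P \<mu> \<Omega> s (BRealLess a b) \<longleftrightarrow> rval P \<mu> \<Omega> s a < rval P \<mu> \<Omega> s b"
| "bval P \<mu> \<Omega> s (BNot a) \<longleftrightarrow> \<not> bval P \<mu> \<Omega> s a"
| "bval P \<mu> \<Omega> s (BAnd a b) \<longleftrightarrow> bval P \<mu> \<Omega> s a \<and> bval P \<mu> \<Omega> s b"

primrec icost :: "iexp \<Rightarrow> nat" where
  "icost (ICon c) = 1"
| "icost (IReg x) = 1"
| "icost (IArr x a b) = 1 + icost a + icost b"
| "icost (IAdd a b) = 1 + icost a + icost b"
| "icost (ISub a b) = 1 + icost a + icost b"
| "icost IProducts = 1"
| "icost ITypes = 1"
| "icost IPeriods = 1"
| "icost (IInventory a) = 1 + icost a"
| "icost (ISupportSize a b) = 1 + icost a + icost b"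

primrec rcost :: "rexp \<Rightarrow> nat" where
  "rcost (RCon c) = 1"
| "rcost (RReg x) = 1"
| "rcost (RArr x a b) = 1 + icost a + icost b"
| "rcost (RAdd a b) = 1 + rcost a + rcost b"
| "rcost (RSub a b) = 1 + rcost a + rcost b"
| "rcost (RMul a b) = 1 + rcost a + rcost b"
| "rcost (RDiv a b) = 1 + rcost a + rcost b"
| "rcost (RRevenue a) = 1 + icost a"
| "rcost (RArrive a b) = 1 + icost a + icost b"
| "rcost (RProb a b c) = 1 + icost a + icost b + icost c"
| "rcost (RPick d a b c) = 1 + icost d + icost a + icost b + icost c"

primrec bcost :: "bexp \<Rightarrow> nat" where
  "bcost (BIndexLess a b) = 1 + icost a + icost b"
| "bcost (BRealLess a b) = 1 + rcost a + rcost b"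
| "bcost (BNot a) = 1 + bcost a"
| "bcost (BAnd a b) = 1 + bcost a + bcost b"

text \<open>\<open>exec P \<mu> \<Omega> c s k s'\<close>: started in \<open>s\<close>, \<open>c\<close> terminates in \<open>s'\<close> after exactly \<open>k\<close> operations.\<close>

inductive exec ::
  "problem \<Rightarrow> policy \<Rightarrow> supports \<Rightarrow> com \<Rightarrow> state \<Rightarrow> nat \<Rightarrow> state \<Rightarrow> bool"
  for P \<mu> \<Omega> where
  Skip: "exec P \<mu> \<Omega> Skip s 1 s"
| SetIReg: "exec P \<mu> \<Omega> (SetIReg x e) s (1 + icost e)
     (s\<lparr>ireg := (ireg s)(x := ival P \<Omega> s e)\<rparr>)"
| SetIArr: "exec P \<mu> \<Omega> (SetIArr x a b e) s (1 + icost a + icost b + icost e)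
     (s\<lparr>iarr := (iarr s)(x := (iarr s x)(ival P \<Omega> s a :=
        (iarr s x (ival P \<Omega> s a))(ival P \<Omega> s b := ival P \<Omega> s e)))\<rparr>)"
| SetRReg: "exec P \<mu> \<Omega> (SetRReg x e) s (1 + rcost e)
     (s\<lparr>rreg := (rreg s)(x := rval P \<mu> \<Omega> s e)\<rparr>)"
| SetRArr: "exec P \<mu> \<Omega> (SetRArr x a b e) s (1 + icost a + icost b + rcost e)
     (s\<lparr>rarr := (rarr s)(x := (rarr s x)(ival P \<Omega> s a :=
        (rarr s x (ival P \<Omega> s a))(ival P \<Omega> s b := rval P \<mu> \<Omega> s e)))\<rparr>)"
| Seq: "exec P \<mu> \<Omega> c1 s1 k1 s2 \<Longrightarrow> exec P \<mu> \<Omega> c2 s2 k2 s3 \<Longrightarrow>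
     exec P \<mu> \<Omega> (Seq c1 c2) s1 (k1 + k2) s3"
| IfTrue: "bval P \<mu> \<Omega> s b \<Longrightarrow> exec P \<mu> \<Omega> c1 s k s' \<Longrightarrow>
     exec P \<mu> \<Omega> (Cond b c1 c2) s (1 + bcost b + k) s'"
| IfFalse: "\<not> bval P \<mu> \<Omega> s b \<Longrightarrow> exec P \<mu> \<Omega> c2 s k s' \<Longrightarrow>
     exec P \<mu> \<Omega> (Cond b c1 c2) s (1 + bcost b + k) s'"
| WhileFalse: "\<not> bval P \<mu> \<Omega> s b \<Longrightarrow>
     exec P \<mu> \<Omega> (While b c) s (1 + bcost b) s"
| WhileTrue: "bval P \<mu> \<Omega> s1 b \<Longrightarrow> exec P \<mu> \<Omega> c s1 k1 s2 \<Longrightarrow>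
     exec P \<mu> \<Omega> (While b c) s2 k2 s3 \<Longrightarrow>
     exec P \<mu> \<Omega> (While b c) s1 (1 + bcost b + k1 + k2) s3"

text \<open>
  The result is read off the integer array \<open>out\<close>: entry \<open>(j, t)\<close> is the position in \<open>\<Omega> j t\<close> of
  the assortment offered to type \<open>j\<close> in period \<open>t\<close>.
\<close>

definition outputs :: "problem \<Rightarrow> policy \<Rightarrow> supports \<Rightarrow> state \<Rightarrow> policy \<Rightarrow> bool" where
  "outputs P \<mu> \<Omega> s \<eta> \<longleftrightarrow>
     (\<forall>j t. if j \<in> ctypes P \<and> t \<in> periods P
        then iarr s ''out'' j t < length (\<Omega> j t) \<and>
             \<eta> j t = return_pmf (\<Omega> j t ! iarr s ''out'' j t)
        else \<eta> j t = \<mu> j t)"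

end

(*
  Let N be the number of customers choosing product i over the horizon. As the choices in different
  periods are independent, E min(c_i, N) is affine in the probability phi_it that i is chosen in
  period t, with slope P(fewer than c_i choices of i in the other periods). So, with w_i the revenue
  r_i times this slope,

    rev(M_jt(mu, S)) = const + lambda_jt * (sum_i w_i phi_ij(S)),

  where neither the constant nor the w_i depend on S or on the law of S_jt. Averaging over S_jt gives
  rev(mu), so the best S in the support does not decrease the revenue; and it is found by maximizing
  the sum. Since the w_i do not change while the types of one period are treated, they are computed
  once per period, by a dynamic program with O(T^2) steps per product. This costs O(n T^3) in total;
  the maximizations evaluate n + 1 assortments for each of the m T pairs, in O(m n^2 T).
*)

theory Submission
  imports Defs
begin

section \<open>Revenue as an affine function of one random assortment\<close>

text \<open>The weights ignore \<open>offer_prob P \<mu> i t\<close> altogether, and with it the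
  laws of all types in period t; this is why one computation serves a whole period. The bound
  demands it, too: a dynamic program for every pair of type and period would cost m n T^3, which m
  n^2 T^2 + n T^3 does not cover. Expectations are traded at the outset for two recursions over the
  horizon. Affinity then becomes an induction instead of a conditioning argument, and the recursion
  for the slope is the very one that the program tabulates. Maximizers may tie, so the revenue claim
  is proved for every outcome of \<open>greedy\<close>, independently of the program, which follows
  just one of them.\<close>

text \<open>\<open>E min {c, B\<^sub>1 + \<dots> + B\<^sub>h}\<close> for independent Bernoulli \<open>B\<^sub>t\<close> with parameters \<open>p t\<close>.\<close>

primrec capped_mean :: "(nat \<Rightarrow> real) \<Rightarrow> nat \<Rightarrow> nat \<Rightarrow> real" where
  "capped_mean p 0 c = 0"
| "capped_mean p (Suc h) c =
     (if c = 0 then 0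
      else p (Suc h) * (1 + capped_mean p h (c - 1)) + (1 - p (Suc h)) * capped_mean p h c)"

text \<open>\<open>P (B\<^sub>1 + \<dots> + B\<^sub>h < c)\<close>, the expected gain from one additional unit of demand.\<close>

primrec stock_left :: "(nat \<Rightarrow> real) \<Rightarrow> nat \<Rightarrow> nat \<Rightarrow> real" where
  "stock_left p 0 c = (if c = 0 then 0 else 1)"
| "stock_left p (Suc h) c =
     (if c = 0 then 0
      else p (Suc h) * stock_left p h (c - 1) + (1 - p (Suc h)) * stock_left p h c)"

text \<open>Condition on the last coordinate: unless c = 0, a success contributes 1 and leaves
  capacity c - 1 for the rest; a failure leaves c. By independence the law of the rest is the same
  in both cases.\<close>

lemma expectation_capped_count:
  assumes "\<And>t. t \<in> {1..h} \<Longrightarrow> 0 \<le> p t \<and> p t \<le> 1"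
  shows "measure_pmf.expectation (Pi_pmf {1..h} False (\<lambda>t. bernoulli_pmf (p t)))
     (\<lambda>B. real (min c (card {t\<in>{1..h}. B t}))) = capped_mean p h c"
  using assms
proof (induction h arbitrary: c)
  case 0
  then show ?case by simp
next
  case (Suc h)
  let ?M = "\<lambda>h. Pi_pmf {1..h} False (\<lambda>t. bernoulli_pmf (p t))"
  let ?f = "\<lambda>c B. real (min c (card {t\<in>{1..h}. B t}))"
  have fin: "finite (set_pmf (?M h))"
    by (rule finite_subset[OF set_Pi_pmf_subset']) (auto intro!: finite_PiE_dflt)
  have fin_map: "finite (set_pmf (map_pmf g (?M h)))" for g
    using fin by simp
  have IH: "measure_pmf.expectation (?M h) (?f c) = capped_mean p h c" for c
    using Suc by simp
  have ins: "{1..Suc h} = insert (Suc h) {1..h}" by auto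
  have count: "card {t\<in>{1..Suc h}. (B(Suc h := b)) t} = (if b then 1 else 0) + card {t\<in>{1..h}. B t}"
    for B b
  proof -
    have "{t\<in>{1..Suc h}. (B(Suc h := b)) t} =
        (if b then insert (Suc h) {t\<in>{1..h}. B t} else {t\<in>{1..h}. B t})"
      by auto
    then show ?thesis by simp
  qed
  have "measure_pmf.expectation (?M (Suc h)) (\<lambda>B. real (min c (card {t\<in>{1..Suc h}. B t}))) =
      (\<Sum>b\<in>UNIV. pmf (bernoulli_pmf (p (Suc h))) b *
        measure_pmf.expectation (?M h) (\<lambda>B. real (min c ((if b then 1 else 0) + card {t\<in>{1..h}. B t}))))"
  proof -
    have "?M (Suc h) = bernoulli_pmf (p (Suc h)) \<bind> (\<lambda>b. map_pmf (\<lambda>B. B(Suc h := b)) (?M h))"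
      unfolding ins by (subst Pi_pmf_insert') (auto simp: map_pmf_def)
    then show ?thesis
      by (simp only: pmf_expectation_bind[OF finite fin_map subset_UNIV]
          integral_map_pmf count real_scaleR_def)
  qed
  also have "\<dots> = p (Suc h) * measure_pmf.expectation (?M h)
      (\<lambda>B. real (min c (Suc (card {t\<in>{1..h}. B t})))) + (1 - p (Suc h)) * capped_mean p h c"
    using Suc.prems[of "Suc h"] by (simp add: UNIV_bool IH[simplified])
  also have "measure_pmf.expectation (?M h) (\<lambda>B. real (min c (Suc (card {t\<in>{1..h}. B t})))) =
      (if c = 0 then 0 else 1 + capped_mean p h (c - 1))"
  proof (cases c)
    case (Suc d)
    have "measure_pmf.expectation (?M h) (\<lambda>B. 1 + ?f d B) = 1 + measure_pmf.expectation (?M h) (?f d)"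
      using fin by (subst Bochner_Integration.integral_add) (auto intro: integrable_measure_pmf_finite)
    then show ?thesis using Suc by (simp add: IH[simplified])
  qed simp
  \<comment> \<open>The split on h unfolds \<open>capped_mean p h 0\<close>, which has to vanish
    when c = 0.\<close>
  finally show ?case
    by (cases h) (auto)
qed

lemma stock_left_no_stock [simp]: "stock_left p h 0 = 0"
  by (cases h) auto

lemma capped_mean_no_stock [simp]: "capped_mean p h 0 = 0"
  by (cases h) auto

lemma stock_left_step:
  "0 < h \<Longrightarrow> 0 < c \<Longrightarrow>
   stock_left p h c = p h * stock_left p (h - 1) (c - 1) + (1 - p h) * stock_left p (h - 1) c"
  by (cases h) auto

text \<open>At most h units are demanded, so a larger stock never runs out. This justifies cutting
  the table off at inventory T.\<close>

lemma stock_left_surplus: "h < c \<Longrightarrow> stock_left p h c = 1"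
  by (induction h arbitrary: c) (auto simp: algebra_simps)

lemma capped_mean_cong:
  "(\<And>t. t \<in> {1..h} \<Longrightarrow> p t = q t) \<Longrightarrow> capped_mean p h c = capped_mean q h c"
  by (induction h arbitrary: c) auto

lemma stock_left_cong:
  "(\<And>t. t \<in> {1..h} \<Longrightarrow> p t = q t) \<Longrightarrow> stock_left p h c = stock_left q h c"
  by (induction h arbitrary: c) auto

text \<open>With N the total demand, min {c + 1, N} exceeds min {c, N} by 1 exactly when N > c.
  Hence the increments of the capped mean in c are tail probabilities, and their complements are
  \<open>stock_left\<close>.\<close>

lemma stock_left_Suc:
  "stock_left p h (Suc c) = 1 + capped_mean p h c - capped_mean p h (Suc c)"
proof (induction h arbitrary: c)
  case (Suc h)
  show ?case by (cases c) (simp_all add: Suc.IH algebra_simps)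
qed simp

text \<open>Below the top period both recursions form the same combination of their predecessors, so
  the affine form is inherited. At the top period the slope appears as an increment in c.\<close>

lemma capped_mean_affine:
  assumes "t \<in> {1..h}"
  shows "capped_mean (p(t := x)) h c = capped_mean (p(t := 0)) h c + x * stock_left (p(t := 0)) h c"
  using assms
proof (induction h arbitrary: c)
  case (Suc h)
  show ?case
  proof (cases "t = Suc h")
    case True
    have "capped_mean (p(t := y)) h d = capped_mean p h d"
         "stock_left (p(t := y)) h d = stock_left p h d" for y d
      using True by (auto intro: capped_mean_cong stock_left_cong)
    then have "capped_mean (p(t := y)) (Suc h) c =
        (if c = 0 then 0 else y * (1 + capped_mean p h (c - 1)) + (1 - y) * capped_mean p h c)"
      "stock_left (p(t := 0)) (Suc h) c = stock_left p h c" for y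
      using True by auto
    \<comment> \<open>For c > 0 the coefficient of the top parameter is
      \<open>1 + capped_mean p h (c - 1) - capped_mean p h c\<close>, which
      \<open>stock_left_Suc\<close> identifies; for c = 0 everything is 0.\<close>
    then have "capped_mean (p(t := x)) (Suc h) c - capped_mean (p(t := 0)) (Suc h) c =
        x * stock_left (p(t := 0)) (Suc h) c"
      by (cases c; simp only:) (simp_all add: stock_left_Suc algebra_simps)
    then show ?thesis by linarith
  next
    case False
    then have IH: "capped_mean (p(t := x)) h d =
        capped_mean (p(t := 0)) h d + x * stock_left (p(t := 0)) h d" for d
      using Suc.prems by (intro Suc.IH) auto
    have "(p(t := y)) (Suc h) = p (Suc h)" for y using False by simp
    then show ?thesis
      by (simp only: capped_mean.simps stock_left.simps IH) (simp add: algebra_simps)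
  qed
qed simp

definition mean_pick :: "problem \<Rightarrow> policy \<Rightarrow> nat \<Rightarrow> nat \<Rightarrow> nat \<Rightarrow> real" where
  "mean_pick P \<mu> i j t = (\<Sum>S\<in>Pow (products P). pmf (\<mu> j t) S * pick P i j S)"

text \<open>Setting the parameter of period \<open>t\<close> to 0 removes \<open>B\<^sub>t\<close> from the sum.\<close>

definition marginal_value :: "problem \<Rightarrow> policy \<Rightarrow> nat \<Rightarrow> nat \<Rightarrow> real" where
  "marginal_value P \<mu> t i =
     revenue P i * stock_left ((offer_prob P \<mu> i)(t := 0)) (horizon P) (inventory P i)"

lemma offer_prob_mean_pick:
  "offer_prob P \<mu> i t = (\<Sum>j\<in>ctypes P. arrive P j t * mean_pick P \<mu> i j t)"
  by (simp add: offer_prob_def mean_pick_def)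

lemma mean_pick_return:
  assumes "\<mu> j t = return_pmf S" "S \<subseteq> products P"
  shows "mean_pick P \<mu> i j t = pick P i j S"
proof -
  have "mean_pick P \<mu> i j t = (\<Sum>S'\<in>Pow (products P). if S' = S then pick P i j S else 0)"
    unfolding mean_pick_def by (intro sum.cong) (auto simp: assms indicator_def)
  then show ?thesis using assms by simp
qed

lemma valid_policy_replace:
  "valid_policy P \<mu> \<Longrightarrow> S \<subseteq> products P \<Longrightarrow> valid_policy P (replace j t \<mu> S)"
  by (auto simp: valid_policy_def replace_def)

lemma exp_revenue_capped_mean:
  assumes V: "valid_problem P" "valid_policy P \<mu>"
  shows "exp_revenue P \<mu> =
    (\<Sum>i\<in>products P. revenue P i * capped_mean (offer_prob P \<mu> i) (horizon P) (inventory P i))"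
proof -
  \<comment> \<open>The bounds hold because \<open>pmf_period\<close> exhibits
    \<open>offer_prob\<close> as an actual probability; the double sum need not be
    estimated.\<close>
  have "0 \<le> offer_prob P \<mu> i t \<and> offer_prob P \<mu> i t \<le> 1"
    if "i \<in> products P" "t \<in> {1..horizon P}" for i t
    using pmf_period[OF V, of t i] that pmf_nonneg pmf_le_1 by (metis periods_def)
  then show ?thesis
    unfolding exp_revenue_formula[OF V] periods_def
    by (intro sum.cong refl arg_cong2[where f = "(*)"] expectation_capped_count) auto
qed

text \<open>Only the parameter of period t moves, and \<open>marginal_value\<close> is the slope.
  The expansion is taken around \<open>\<mu>\<close> and not around an empty offer: no constant
  needs a name, and the corrections average to 0 over \<open>\<mu> j t\<close>.\<close>

lemma exp_revenue_replace:
  assumes V: "valid_problem P" "valid_policy P \<mu>"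
    and j: "j \<in> ctypes P" and t: "t \<in> periods P" and S: "S \<subseteq> products P"
  shows "exp_revenue P (replace j t \<mu> S) = exp_revenue P \<mu> + arrive P j t *
    ((\<Sum>i\<in>products P. marginal_value P \<mu> t i * pick P i j S) -
     (\<Sum>i\<in>products P. marginal_value P \<mu> t i * mean_pick P \<mu> i j t))"
proof -
  let ?\<nu> = "replace j t \<mu> S"
  have off: "offer_prob P ?\<nu> i = (offer_prob P \<mu> i)
      (t := offer_prob P \<mu> i t + arrive P j t * (pick P i j S - mean_pick P \<mu> i j t))" for i
  proof
    fix u
    show "offer_prob P ?\<nu> i u = ((offer_prob P \<mu> i)
      (t := offer_prob P \<mu> i t + arrive P j t * (pick P i j S - mean_pick P \<mu> i j t))) u"
    proof (cases "u = t")
      case False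
      then have "?\<nu> j' u = \<mu> j' u" for j' by (simp add: replace_def)
      then show ?thesis using False by (simp add: offer_prob_def)
    next
      case True
      have "mean_pick P ?\<nu> i j' t = (if j' = j then pick P i j S else mean_pick P \<mu> i j' t)" for j'
        using mean_pick_return[of ?\<nu> j t S P] S by (auto simp: replace_def mean_pick_def)
      then show ?thesis using True j
        by (simp add: offer_prob_mean_pick sum.remove[of "ctypes P" j] algebra_simps)
    qed
  qed
  \<comment> \<open>Affinity is used twice, for x and for \<open>p t\<close> itself, to move the
    base point from 0 to \<open>p t\<close>.\<close>
  have aff: "capped_mean (p(t := x)) (horizon P) c =
      capped_mean p (horizon P) c + (x - p t) * stock_left (p(t := 0)) (horizon P) c" for p x c
    using capped_mean_affine[of t "horizon P" p x c] capped_mean_affine[of t "horizon P" p "p t" c] t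
    by (simp add: periods_def algebra_simps)
  show ?thesis
    unfolding exp_revenue_capped_mean[OF V] exp_revenue_capped_mean[OF V(1) valid_policy_replace[OF V(2) S]]
      off aff marginal_value_def
    by (simp add: algebra_simps sum.distrib sum_distrib_left sum_subtractf)
qed

text \<open>As \<open>mean_pick\<close> is the mean of \<open>pick\<close>, the corrections of
  \<open>exp_revenue_replace\<close> cancel on average; the sales process itself is not decomposed
  again.\<close>

lemma exp_revenue_mean_replace:
  assumes V: "valid_problem P" "valid_policy P \<mu>"
    and j: "j \<in> ctypes P" and t: "t \<in> periods P"
  shows "(\<Sum>S\<in>set_pmf (\<mu> j t). pmf (\<mu> j t) S * exp_revenue P (replace j t \<mu> S)) = exp_revenue P \<mu>"
proof -
  let ?q = "pmf (\<mu> j t)" and ?A = "set_pmf (\<mu> j t)" and ?w = "marginal_value P \<mu> t"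
  have sub: "?A \<subseteq> Pow (products P)" using V(2) j t by (auto simp: valid_policy_def)
  then have fin: "finite ?A" by (rule finite_subset) simp
  have one: "sum ?q ?A = 1" using fin by (simp add: sum_pmf_eq_1)
  have mp: "mean_pick P \<mu> i j t = (\<Sum>S\<in>?A. ?q S * pick P i j S)" for i
    unfolding mean_pick_def
    by (rule sum.mono_neutral_right) (use sub in \<open>auto simp: set_pmf_iff\<close>)
  define R where "R S = (\<Sum>i\<in>products P. ?w i * pick P i j S)" for S
  define M where "M = (\<Sum>i\<in>products P. ?w i * mean_pick P \<mu> i j t)"
  have "(\<Sum>S\<in>?A. ?q S * R S) = M"
    unfolding R_def M_def mp by (simp add: sum_distrib_left mult_ac) (rule sum.swap)
  moreover have "(\<Sum>S\<in>?A. ?q S * exp_revenue P (replace j t \<mu> S)) =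
      (\<Sum>S\<in>?A. ?q S * (exp_revenue P \<mu> + arrive P j t * (R S - M)))"
    unfolding R_def M_def
    using sub by (intro sum.cong refl) (subst exp_revenue_replace[OF V j t], auto)
  moreover have "\<dots> = sum ?q ?A * (exp_revenue P \<mu> - arrive P j t * M)
      + arrive P j t * (\<Sum>S\<in>?A. ?q S * R S)"
    by (simp add: sum_distrib_left sum_distrib_right sum.distrib sum_subtractf algebra_simps)
  ultimately show ?thesis by (simp add: one algebra_simps)
qed

lemma arg_max_replace_ge:
  assumes V: "valid_problem P" "valid_policy P \<mu>"
    and j: "j \<in> ctypes P" and t: "t \<in> periods P"
    and S: "is_arg_max (\<lambda>S. exp_revenue P (replace j t \<mu> S)) (\<lambda>S. S \<in> set_pmf (\<mu> j t)) S"
  shows "exp_revenue P \<mu> \<le> exp_revenue P (replace j t \<mu> S)"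
proof -
  have "set_pmf (\<mu> j t) \<subseteq> Pow (products P)" using V(2) j t by (auto simp: valid_policy_def)
  then have fin: "finite (set_pmf (\<mu> j t))" by (rule finite_subset) simp
  have "exp_revenue P \<mu> \<le> (\<Sum>S'\<in>set_pmf (\<mu> j t). pmf (\<mu> j t) S' * exp_revenue P (replace j t \<mu> S))"
    unfolding exp_revenue_mean_replace[OF V j t, symmetric] using S
    by (intro sum_mono mult_left_mono) (auto simp: is_arg_max_def not_less)
  also have "\<dots> = exp_revenue P (replace j t \<mu> S)"
    using fin by (simp add: sum_distrib_right[symmetric] sum_pmf_eq_1)
  finally show ?thesis .
qed

section \<open>Greedy steps: supports, existence and monotone revenue\<close>

lemma greedy_steps_append:
  "greedy_steps P (ps @ qs) \<mu> \<eta> \<longleftrightarrow> (\<exists>\<nu>. greedy_steps P ps \<mu> \<nu> \<and> greedy_steps P qs \<nu> \<eta>)"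
  by (induction ps arbitrary: \<mu>) (auto split: prod.splits)

text \<open>Each step puts a point mass inside the current support, so supports only shrink. This
  yields membership in the original support, validity of the resulting policy, and the fact that a
  decided assortment stays decided.\<close>

lemma set_greedy_steps: "greedy_steps P ps \<mu> \<eta> \<Longrightarrow> set_pmf (\<eta> j t) \<subseteq> set_pmf (\<mu> j t)"
proof (induction ps arbitrary: \<mu>)
  case (Cons p ps)
  obtain j' t' where p: "p = (j', t')" by force
  obtain S where S: "S \<in> set_pmf (\<mu> j' t')" and g: "greedy_steps P ps (replace j' t' \<mu> S) \<eta>"
    using Cons.prems by (auto simp: p is_arg_max_def)
  show ?case using Cons.IH[OF g] S by (auto simp: replace_def split: if_splits)
qed simp

lemma valid_policy_greedy_steps:
  "greedy_steps P ps \<mu> \<eta> \<Longrightarrow> valid_policy P \<mu> \<Longrightarrow> valid_policy P \<eta>"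
  using set_greedy_steps[of P ps \<mu> \<eta>] unfolding valid_policy_def by blast

text \<open>The maxima are attained because the supports of a valid policy consist of subsets of a
  finite set of products.\<close>

lemma greedy_steps_exists:
  assumes "set ps \<subseteq> ctypes P \<times> periods P" "valid_policy P \<mu>"
  shows "\<exists>\<eta>. greedy_steps P ps \<mu> \<eta>"
  using assms
proof (induction ps arbitrary: \<mu>)
  case (Cons p ps)
  obtain j t where p: "p = (j, t)" by force
  then have sub: "set_pmf (\<mu> j t) \<subseteq> Pow (products P)"
    using Cons.prems by (auto simp: valid_policy_def)
  then have fin: "finite (set_pmf (\<mu> j t))" by (rule finite_subset) simp
  obtain S where "S \<in> set_pmf (\<mu> j t)"
      "exp_revenue P (replace j t \<mu> S) = (MAX S\<in>set_pmf (\<mu> j t). exp_revenue P (replace j t \<mu> S))"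
    using obtains_MAX[OF fin set_pmf_not_empty] by metis
  then have S: "is_arg_max (\<lambda>S. exp_revenue P (replace j t \<mu> S)) (\<lambda>S. S \<in> set_pmf (\<mu> j t)) S"
    using fin by (simp add: is_arg_max_linorder)
  then have "S \<subseteq> products P" using sub by (auto simp: is_arg_max_def)
  then obtain \<eta> where "greedy_steps P ps (replace j t \<mu> S) \<eta>"
    using Cons.IH[of "replace j t \<mu> S"] Cons.prems valid_policy_replace by auto
  then show ?case using S by (auto simp: p)
qed auto

lemma greedy_steps_deterministic:
  assumes "greedy_steps P ps \<mu> \<eta>" "(j, t) \<in> set ps"
  shows "\<exists>S. \<eta> j t = return_pmf S"
  using assms
proof (induction ps arbitrary: \<mu>)
  case (Cons p ps)
  obtain j' t' where p: "p = (j', t')" by force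
  obtain S where g: "greedy_steps P ps (replace j' t' \<mu> S) \<eta>"
    using Cons.prems by (auto simp: p)
  show ?case
  proof (cases "(j, t) = (j', t')")
    case True
    then have "set_pmf (\<eta> j t) \<subseteq> {S}"
      using set_greedy_steps[OF g, of j t] by (simp add: replace_def)
    then have "\<eta> j t = return_pmf S" by (simp add: set_pmf_subset_singleton)
    then show ?thesis ..
  next
    case False
    then show ?thesis using Cons g by (auto simp: p)
  qed
qed simp

lemma greedy_steps_revenue:
  assumes "valid_problem P" "set ps \<subseteq> ctypes P \<times> periods P" "valid_policy P \<mu>"
    "greedy_steps P ps \<mu> \<eta>"
  shows "exp_revenue P \<mu> \<le> exp_revenue P \<eta>"
  using assms(2-)
proof (induction ps arbitrary: \<mu>)
  case (Cons p ps)
  obtain j t where p: "p = (j, t)" by force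
  obtain S where S: "is_arg_max (\<lambda>S. exp_revenue P (replace j t \<mu> S)) (\<lambda>S. S \<in> set_pmf (\<mu> j t)) S"
      and g: "greedy_steps P ps (replace j t \<mu> S) \<eta>"
    using Cons.prems by (auto simp: p)
  have "S \<subseteq> products P"
    using S Cons.prems by (auto simp: p is_arg_max_def valid_policy_def)
  then have "exp_revenue P (replace j t \<mu> S) \<le> exp_revenue P \<eta>"
    using Cons g by (intro Cons.IH valid_policy_replace) auto
  then show ?case
    using arg_max_replace_ge[OF assms(1) Cons.prems(2) _ _ S] Cons.prems(1) by (simp add: p)
qed simp

lemma set_greedy_order:
  "set [(j, t). t \<leftarrow> [1..<Suc (horizon P)], j \<leftarrow> [1..<Suc (ntype P)]] = ctypes P \<times> periods P"
  unfolding ctypes_def periods_def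
  by (simp del: upt_Suc add: atLeastLessThanSuc_atLeastAtMost image_iff) auto

theorem greedy_revenue:
  assumes "valid_problem P" "valid_policy P \<mu>"
  shows "(\<exists>\<eta>. greedy P \<mu> \<eta>) \<and>
            (\<forall>\<eta>. greedy P \<mu> \<eta> \<longrightarrow>
               (\<forall>j\<in>ctypes P. \<forall>t\<in>periods P. \<exists>S\<in>set_pmf (\<mu> j t). \<eta> j t = return_pmf S) \<and>
               exp_revenue P \<mu> \<le> exp_revenue P \<eta>)"
proof -
  define ps where "ps = [(j, t). t \<leftarrow> [1..<Suc (horizon P)], j \<leftarrow> [1..<Suc (ntype P)]]"
  have greedy: "greedy P \<mu> \<eta> \<longleftrightarrow> greedy_steps P ps \<mu> \<eta>" for \<eta>
    unfolding greedy_def ps_def ..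
  have ps: "set ps = ctypes P \<times> periods P"
    unfolding ps_def by (rule set_greedy_order)
  have "\<exists>S\<in>set_pmf (\<mu> j t). \<eta> j t = return_pmf S"
    if g: "greedy_steps P ps \<mu> \<eta>" and "j \<in> ctypes P" "t \<in> periods P" for \<eta> j t
  proof -
    have "(j, t) \<in> set ps" using that(2,3) ps by simp
    then obtain S where S: "\<eta> j t = return_pmf S"
      using greedy_steps_deterministic[OF g] by metis
    moreover have "S \<in> set_pmf (\<mu> j t)" using set_greedy_steps[OF g, of j t] S by simp
    ultimately show ?thesis by blast
  qed
  then show ?thesis
    using assms greedy_steps_exists[of ps P \<mu>] greedy_steps_revenue[of P ps \<mu>] ps
    by (simp add: greedy)
qed

section \<open>Runs of bounded cost\<close>

text \<open>One location per array, not per cell: effects on single cells are left to the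
  postconditions and invariants. The kind belongs to the location because the four kinds of storage
  have separate name spaces.\<close>

datatype loc = IReg_loc string | IArr_loc string | RReg_loc string | RArr_loc string

primrec writes :: "com \<Rightarrow> loc set" where
  "writes Skip = {}"
| "writes (SetIReg x e) = {IReg_loc x}"
| "writes (SetIArr x a b e) = {IArr_loc x}"
| "writes (SetRReg x e) = {RReg_loc x}"
| "writes (SetRArr x a b e) = {RArr_loc x}"
| "writes (Seq c d) = writes c \<union> writes d"
| "writes (Cond b c d) = writes c \<union> writes d"
| "writes (While b c) = writes c"

definition same_outside :: "loc set \<Rightarrow> state \<Rightarrow> state \<Rightarrow> bool" where
  "same_outside W s s' \<longleftrightarrow>
     (\<forall>x. IReg_loc x \<notin> W \<longrightarrow> ireg s' x = ireg s x) \<and>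
     (\<forall>x. IArr_loc x \<notin> W \<longrightarrow> iarr s' x = iarr s x) \<and>
     (\<forall>x. RReg_loc x \<notin> W \<longrightarrow> rreg s' x = rreg s x) \<and>
     (\<forall>x. RArr_loc x \<notin> W \<longrightarrow> rarr s' x = rarr s x)"

lemma same_outside_trans:
  assumes "same_outside V s1 s2" "same_outside W s2 s3" "V \<union> W \<subseteq> X"
  shows "same_outside X s1 s3"
proof -
  have "l \<notin> V \<and> l \<notin> W" if "l \<notin> X" for l using assms(3) that by auto
  then show ?thesis using assms(1,2) by (simp add: same_outside_def)
qed

text \<open>The frame property: \<open>writes\<close> is read off the syntax, so it covers every
  branch and any number of iterations. Invariants then need to mention only what the loop body
  changes.\<close>

lemma exec_same_outside: "exec P \<mu> \<Omega> c s k s' \<Longrightarrow> same_outside (writes c) s s'"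
proof (induction rule: exec.induct)
  case (Seq c1 s1 k1 s2 c2 k2 s3)
  then show ?case by (auto elim: same_outside_trans)
next
  case (WhileTrue s1 b c k1 s2 k2 s3)
  then show ?case by (auto elim: same_outside_trans)
qed (auto simp: same_outside_def)

text \<open>A Hoare triple for total correctness with an operation budget. Bounding the cost, where
  \<open>exec\<close> counts exactly, lets branches of different cost share one budget.\<close>

definition runs :: "problem \<Rightarrow> policy \<Rightarrow> supports \<Rightarrow> com \<Rightarrow> state \<Rightarrow> nat \<Rightarrow> (state \<Rightarrow> bool) \<Rightarrow> bool" where
  "runs P \<mu> \<Omega> c s N Q \<longleftrightarrow> (\<exists>k s'. exec P \<mu> \<Omega> c s k s' \<and> k \<le> N \<and> Q s')"

lemma runs_weaken:
  assumes "runs P \<mu> \<Omega> c s N Q" "\<And>s'. Q s' \<Longrightarrow> same_outside (writes c) s s' \<Longrightarrow> R s'" "N \<le> M"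
  shows "runs P \<mu> \<Omega> c s M R"
proof -
  obtain k s' where "exec P \<mu> \<Omega> c s k s'" "k \<le> N" "Q s'"
    using assms(1) by (auto simp: runs_def)
  then show ?thesis
    using assms(2,3) exec_same_outside unfolding runs_def
    by (intro exI[of _ k] exI[of _ s']) auto
qed

lemma runs_Skip: "Q s \<Longrightarrow> 1 \<le> N \<Longrightarrow> runs P \<mu> \<Omega> Skip s N Q"
  unfolding runs_def by (intro exI conjI, rule exec.Skip) simp_all

lemma runs_SetIArr:
  "Q (s\<lparr>iarr := (iarr s)(x := (iarr s x)(ival P \<Omega> s a :=
        (iarr s x (ival P \<Omega> s a))(ival P \<Omega> s b := ival P \<Omega> s e)))\<rparr>) \<Longrightarrow>
   1 + icost a + icost b + icost e \<le> N \<Longrightarrow> runs P \<mu> \<Omega> (SetIArr x a b e) s N Q"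
  unfolding runs_def by (intro exI conjI, rule exec.SetIArr) simp_all

lemma runs_SetRReg:
  "Q (s\<lparr>rreg := (rreg s)(x := rval P \<mu> \<Omega> s e)\<rparr>) \<Longrightarrow> 1 + rcost e \<le> N \<Longrightarrow>
   runs P \<mu> \<Omega> (SetRReg x e) s N Q"
  unfolding runs_def by (intro exI conjI, rule exec.SetRReg) simp_all

lemma runs_SetRArr:
  "Q (s\<lparr>rarr := (rarr s)(x := (rarr s x)(ival P \<Omega> s a :=
        (rarr s x (ival P \<Omega> s a))(ival P \<Omega> s b := rval P \<mu> \<Omega> s e)))\<rparr>) \<Longrightarrow>
   1 + icost a + icost b + rcost e \<le> N \<Longrightarrow> runs P \<mu> \<Omega> (SetRArr x a b e) s N Q"
  unfolding runs_def by (intro exI conjI, rule exec.SetRArr) simp_all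

lemma runs_Seq:
  assumes "runs P \<mu> \<Omega> c s M Q"
    and "\<And>s'. Q s' \<Longrightarrow> same_outside (writes c) s s' \<Longrightarrow> runs P \<mu> \<Omega> d s' M' R"
    and "M + M' \<le> N"
  shows "runs P \<mu> \<Omega> (Seq c d) s N R"
proof -
  obtain k s' where 1: "exec P \<mu> \<Omega> c s k s'" "k \<le> M" "Q s'"
    using assms(1) by (auto simp: runs_def)
  then obtain k' s'' where 2: "exec P \<mu> \<Omega> d s' k' s''" "k' \<le> M'" "R s''"
    using assms(2)[OF 1(3) exec_same_outside[OF 1(1)]] by (auto simp: runs_def)
  have "exec P \<mu> \<Omega> (Seq c d) s (k + k') s''"
    using 1 2 by (auto intro: exec.Seq)
  then show ?thesis using 1 2 assms(3) unfolding runs_def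
    by (intro exI[of _ "k + k'"] exI[of _ s'']) simp
qed

lemma runs_Cond:
  assumes "bval P \<mu> \<Omega> s b \<Longrightarrow> runs P \<mu> \<Omega> c s M Q"
    and "\<not> bval P \<mu> \<Omega> s b \<Longrightarrow> runs P \<mu> \<Omega> d s M Q"
    and "1 + bcost b + M \<le> N"
  shows "runs P \<mu> \<Omega> (Cond b c d) s N Q"
proof (cases "bval P \<mu> \<Omega> s b")
  case True
  then obtain k s' where 1: "exec P \<mu> \<Omega> c s k s'" "k \<le> M" "Q s'"
    using assms(1) by (auto simp: runs_def)
  then have "exec P \<mu> \<Omega> (Cond b c d) s (1 + bcost b + k) s'"
    using True by (intro exec.IfTrue)
  then show ?thesis using 1 assms(3) unfolding runs_def
    by (intro exI[of _ "1 + bcost b + k"] exI[of _ s']) simp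
next
  case False
  then obtain k s' where 1: "exec P \<mu> \<Omega> d s k s'" "k \<le> M" "Q s'"
    using assms(2) by (auto simp: runs_def)
  then have "exec P \<mu> \<Omega> (Cond b c d) s (1 + bcost b + k) s'"
    using False by (intro exec.IfFalse)
  then show ?thesis using 1 assms(3) unfolding runs_def
    by (intro exI[of _ "1 + bcost b + k"] exI[of _ s']) simp
qed

text \<open>The bound \<open>hi\<close> is exclusive and evaluated anew at every test, so a loop
  rule has to assume that the body preserves its value. All bounds below, \<open>IAdd\<close> of a
  size and 1 or \<open>ISupportSize\<close> of two registers, cost 3.\<close>

definition For :: "string \<Rightarrow> iexp \<Rightarrow> iexp \<Rightarrow> com \<Rightarrow> com" where
  "For x lo hi c = Seq (SetIReg x lo)
     (While (BIndexLess (IReg x) hi) (Seq c (SetIReg x (IAdd (IReg x) (ICon 1)))))"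

lemma writes_For [simp]: "writes (For x lo hi c) = insert (IReg_loc x) (writes c)"
  by (auto simp: For_def)

text \<open>
  Test and increment cost 10 per iteration; initialization and final test cost 8 per loop, which
  \<open>1 \<le> H\<close> allows to charge to the iterations.
\<close>

lemma runs_For:
  fixes s :: state
  assumes W_def: "W = insert (IReg_loc x) (writes c)"
    and lo: "ival P \<Omega> s lo = a" "icost lo = 1"
    and hi: "icost hi = 3" "\<And>s'. same_outside W s s' \<Longrightarrow> ival P \<Omega> s' hi = b"
    and x: "IReg_loc x \<notin> writes c"
    and ab: "a \<le> b" "b - a \<le> H" "1 \<le> H"
    and init: "Inv a (s\<lparr>ireg := (ireg s)(x := a)\<rparr>)"
    and step: "\<And>k s'. \<lbrakk>a \<le> k; k < b; Inv k s'; ireg s' x = k; same_outside W s s'\<rbrakk> \<Longrightarrow>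
      runs P \<mu> \<Omega> c s' N (\<lambda>s''. Inv (Suc k) (s''\<lparr>ireg := (ireg s'')(x := Suc k)\<rparr>))"
    and fin: "\<And>s'. Inv b s' \<Longrightarrow> same_outside W s s' \<Longrightarrow> Q s'"
    and M: "H * (N + 18) \<le> M"
  shows "runs P \<mu> \<Omega> (For x lo hi c) s M Q"
proof -
  let ?c = "Seq c (SetIReg x (IAdd (IReg x) (ICon 1)))"
  let ?b = "BIndexLess (IReg x) hi"
  \<comment> \<open>One test costs 6 and one increment 4; the final 6 pays for the failing
    test.\<close>
  have loop: "\<exists>n s''. exec P \<mu> \<Omega> (While ?b ?c) s' n s'' \<and> n \<le> (b - k) * (N + 10) + 6 \<and> Inv b s''
      \<and> same_outside W s s''"
    if "a \<le> k" "k \<le> b" "Inv k s'" "ireg s' x = k" "same_outside W s s'" for k s'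
    using that
  proof (induction "b - k" arbitrary: k s')
    case 0
    then have "exec P \<mu> \<Omega> (While ?b ?c) s' (1 + bcost ?b) s'"
      by (intro exec.WhileFalse) (simp add: hi)
    then show ?case using 0 hi(1) by (intro exI[of _ "1 + bcost ?b"] exI[of _ s']) simp
  next
    case (Suc d)
    then have k: "k < b" and d: "d = b - Suc k" by simp_all
    obtain n1 s1 where 1: "exec P \<mu> \<Omega> c s' n1 s1" "n1 \<le> N"
      "Inv (Suc k) (s1\<lparr>ireg := (ireg s1)(x := Suc k)\<rparr>)"
      using step[OF Suc.prems(1) k Suc.prems(3-5)] by (auto simp: runs_def)
    have x1: "ireg s1 x = k"
      using exec_same_outside[OF 1(1)] x Suc.prems(4) by (simp add: same_outside_def)
    let ?s2 = "s1\<lparr>ireg := (ireg s1)(x := Suc k)\<rparr>"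
    have "exec P \<mu> \<Omega> ?c s' (n1 + 4) (s1\<lparr>ireg := (ireg s1)(x := ival P \<Omega> s1 (IAdd (IReg x) (ICon 1)))\<rparr>)"
      using exec.Seq[OF 1(1) exec.SetIReg[of _ _ _ x "IAdd (IReg x) (ICon 1)"]]
      by (simp add: numeral_eq_Suc)
    then have c: "exec P \<mu> \<Omega> ?c s' (n1 + 4) ?s2" by (simp add: x1)
    have W2: "same_outside W s ?s2"
      using Suc.prems(5) exec_same_outside[OF c] by (rule same_outside_trans) (auto simp: W_def)
    obtain n s'' where 2: "exec P \<mu> \<Omega> (While ?b ?c) ?s2 n s''" "n \<le> (b - Suc k) * (N + 10) + 6"
       "Inv b s''" "same_outside W s s''"
      using Suc.hyps(1)[OF d _ _ 1(3) _ W2] Suc.prems(1) k by (auto simp del: One_nat_def)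
    have "exec P \<mu> \<Omega> (While ?b ?c) s' (1 + bcost ?b + (n1 + 4) + n) s''"
      using Suc.prems k hi by (intro exec.WhileTrue[OF _ c 2(1)]) simp
    moreover have "1 + bcost ?b + (n1 + 4) + n \<le> (b - k) * (N + 10) + 6"
    proof -
      have "(b - k) * (N + 10) = (b - Suc k) * (N + 10) + (N + 10)"
        using k by (metis Suc_diff_Suc add.commute mult_Suc)
      then show ?thesis using 1(2) 2(2) hi(1) by simp
    qed
    ultimately show ?case
      using 2 by (intro exI[of _ "1 + bcost ?b + (n1 + 4) + n"] exI[of _ s'']) simp
  qed
  let ?s1 = "s\<lparr>ireg := (ireg s)(x := a)\<rparr>"
  have "same_outside W s ?s1" by (simp add: same_outside_def W_def)
  then obtain n s'' where 1: "exec P \<mu> \<Omega> (While ?b ?c) ?s1 n s''" "n \<le> (b - a) * (N + 10) + 6"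
      "Inv b s''" "same_outside W s s''"
    using loop[of a ?s1] init ab(1) by auto
  have "exec P \<mu> \<Omega> (SetIReg x lo) s 2 ?s1"
    using exec.SetIReg[of P \<mu> \<Omega> x lo s] by (simp add: lo numeral_2_eq_2)
  then have "exec P \<mu> \<Omega> (For x lo hi c) s (2 + n) s''"
    unfolding For_def using 1(1) by (rule exec.Seq)
  moreover have "2 + n \<le> M"
  proof -
    have "2 + n \<le> (b - a) * (N + 10) + 8" using 1(2) by simp
    also have "\<dots> \<le> H * (N + 10) + H * 8" using ab by (intro add_mono mult_mono) auto
    also have "\<dots> = H * (N + 18)" by (simp add: algebra_simps)
    finally show ?thesis using M by simp
  qed
  ultimately show ?thesis using fin[OF 1(3,4)] unfolding runs_def
    by (intro exI[of _ "2 + n"] exI[of _ s'']) simp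
qed

section \<open>The program\<close>

text \<open>
  \<open>phi\<close> at \<open>(i, t)\<close> holds \<open>\<phi>\<^sup>\<mu>\<^sub>i\<^sub>t\<close>, \<open>G\<close> at \<open>(h, c)\<close> the value \<open>stock_left\<close> for the current product, and
  \<open>w\<close> at \<open>(i, 0)\<close> the marginal value of \<open>i\<close> in the current period. While period \<open>t\<close> is treated, column
  \<open>t\<close> of \<open>phi\<close> is zero at first, as the dynamic program requires, and is then rebuilt type by type
  from the chosen assortments.
\<close>

definition offer_step :: com where
  "offer_step =
     SetRReg ''acc'' (RAdd (RReg ''acc'')
       (RMul (RArrive (IReg ''j'') (IReg ''t''))
         (RMul (RProb (IReg ''j'') (IReg ''t'') (IReg ''k''))
           (RPick (IReg ''i'') (IReg ''j'') (IReg ''t'') (IReg ''k'')))))"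

definition offer_type :: com where
  "offer_type = For ''k'' (ICon 0) (ISupportSize (IReg ''j'') (IReg ''t'')) offer_step"

definition offer_cell :: com where
  "offer_cell =
     Seq (SetRReg ''acc'' (RCon 0))
    (Seq (For ''j'' (ICon 1) (IAdd ITypes (ICon 1)) offer_type)
         (SetRArr ''phi'' (IReg ''i'') (IReg ''t'') (RReg ''acc'')))"

definition offer_period :: com where
  "offer_period = For ''i'' (ICon 1) (IAdd IProducts (ICon 1)) offer_cell"

definition offer_table :: com where
  "offer_table = For ''t'' (ICon 1) (IAdd IPeriods (ICon 1)) offer_period"

text \<open>The tests keep the recursive case away from both borders, so its truncated subtractions
  are genuine predecessors. The test of c precedes that of h, because
  \<open>stock_left p 0 0\<close> is 0 and not 1.\<close>

definition stock_cell :: com where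
  "stock_cell =
     Cond (BIndexLess (ICon 0) (IReg ''c''))
       (Cond (BIndexLess (ICon 0) (IReg ''h''))
         (SetRArr ''G'' (IReg ''h'') (IReg ''c'')
           (RAdd
             (RMul (RArr ''phi'' (IReg ''i'') (IReg ''h''))
               (RArr ''G'' (ISub (IReg ''h'') (ICon 1)) (ISub (IReg ''c'') (ICon 1))))
             (RMul (RSub (RCon 1) (RArr ''phi'' (IReg ''i'') (IReg ''h'')))
               (RArr ''G'' (ISub (IReg ''h'') (ICon 1)) (IReg ''c'')))))
         (SetRArr ''G'' (IReg ''h'') (IReg ''c'') (RCon 1)))
       (SetRArr ''G'' (IReg ''h'') (IReg ''c'') (RCon 0))"

definition stock_row :: com where
  "stock_row = For ''c'' (ICon 0) (IAdd IPeriods (ICon 1)) stock_cell"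

definition stock_table :: com where
  "stock_table = For ''h'' (ICon 0) (IAdd IPeriods (ICon 1)) stock_row"

text \<open>The table stops at \<open>c = T\<close>, because larger inventories cannot run out.\<close>

definition marginal_weight :: com where
  "marginal_weight =
     Cond (BIndexLess IPeriods (IInventory (IReg ''i'')))
       (SetRArr ''w'' (IReg ''i'') (ICon 0) (RRevenue (IReg ''i'')))
       (SetRArr ''w'' (IReg ''i'') (ICon 0)
         (RMul (RRevenue (IReg ''i'')) (RArr ''G'' IPeriods (IInventory (IReg ''i'')))))"

definition marginal_step :: com where
  "marginal_step =
     Seq (SetRArr ''phi'' (IReg ''i'') (IReg ''t'') (RCon 0)) (Seq stock_table marginal_weight)"

definition marginals :: com where
  "marginals = For ''i'' (ICon 1) (IAdd IProducts (ICon 1)) marginal_step"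

definition score_step :: com where
  "score_step =
     SetRReg ''val'' (RAdd (RReg ''val'')
       (RMul (RArr ''w'' (IReg ''i'') (ICon 0))
         (RPick (IReg ''i'') (IReg ''j'') (IReg ''t'') (IReg ''k''))))"

definition score :: com where
  "score =
     Seq (SetRReg ''val'' (RCon 0))
      (For ''i'' (ICon 1) (IAdd IProducts (ICon 1)) score_step)"

text \<open>The candidate k = 0 is taken unconditionally, since \<open>best\<close> may hold a
  leftover value unrelated to the current candidates. Afterwards only strict improvements count, so
  the first maximizer of the enumeration wins.\<close>

definition compare :: com where
  "compare =
     Cond (BAnd (BIndexLess (ICon 0) (IReg ''k''))
                (BNot (BRealLess (RReg ''best'') (RReg ''val''))))
       Skip
       (Seq (SetRReg ''best'' (RReg ''val''))
            (SetIArr ''out'' (IReg ''j'') (IReg ''t'') (IReg ''k'')))"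

definition select :: com where
  "select = For ''k'' (ICon 0) (ISupportSize (IReg ''j'') (IReg ''t'')) (Seq score compare)"

definition update_step :: com where
  "update_step =
     SetRArr ''phi'' (IReg ''i'') (IReg ''t'')
       (RAdd (RArr ''phi'' (IReg ''i'') (IReg ''t''))
         (RMul (RArrive (IReg ''j'') (IReg ''t''))
           (RPick (IReg ''i'') (IReg ''j'') (IReg ''t'')
             (IArr ''out'' (IReg ''j'') (IReg ''t'')))))"

definition update :: com where
  "update = For ''i'' (ICon 1) (IAdd IProducts (ICon 1)) update_step"

definition type_loop :: com where
  "type_loop = For ''j'' (ICon 1) (IAdd ITypes (ICon 1)) (Seq select update)"

definition period_loop :: com where
  "period_loop = For ''t'' (ICon 1) (IAdd IPeriods (ICon 1)) (Seq marginals type_loop)"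

text \<open>The offer probabilities are tabulated only once and then maintained column by column,
  whereas the table \<open>G\<close> is rebuilt for every product and period.\<close>

definition greedy_program :: com where
  "greedy_program = Seq offer_table period_loop"

lemma writes_blocks [simp]:
  "writes offer_step = {RReg_loc ''acc''}"
  "writes offer_type = {IReg_loc ''k'', RReg_loc ''acc''}"
  "writes offer_cell = {IReg_loc ''j'', IReg_loc ''k'', RReg_loc ''acc'', RArr_loc ''phi''}"
  "writes offer_period =
     {IReg_loc ''i'', IReg_loc ''j'', IReg_loc ''k'', RReg_loc ''acc'', RArr_loc ''phi''}"
  "writes stock_cell = {RArr_loc ''G''}"
  "writes stock_row = {IReg_loc ''c'', RArr_loc ''G''}"
  "writes stock_table = {IReg_loc ''h'', IReg_loc ''c'', RArr_loc ''G''}"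
  "writes marginal_weight = {RArr_loc ''w''}"
  "writes marginal_step =
     {RArr_loc ''phi'', IReg_loc ''h'', IReg_loc ''c'', RArr_loc ''G'', RArr_loc ''w''}"
  "writes marginals =
     {IReg_loc ''i'', RArr_loc ''phi'', IReg_loc ''h'', IReg_loc ''c'', RArr_loc ''G'', RArr_loc ''w''}"
  "writes score_step = {RReg_loc ''val''}"
  "writes score = {RReg_loc ''val'', IReg_loc ''i''}"
  "writes compare = {RReg_loc ''best'', IArr_loc ''out''}"
  "writes select =
     {IReg_loc ''k'', RReg_loc ''val'', IReg_loc ''i'', RReg_loc ''best'', IArr_loc ''out''}"
  "writes update_step = {RArr_loc ''phi''}"
  "writes update = {IReg_loc ''i'', RArr_loc ''phi''}"
  "writes type_loop =
     {IReg_loc ''j'', IReg_loc ''k'', RReg_loc ''val'', IReg_loc ''i'', RReg_loc ''best'',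
      IArr_loc ''out'', RArr_loc ''phi''}"
  by (auto simp: offer_step_def offer_type_def offer_cell_def offer_period_def stock_cell_def
      stock_row_def stock_table_def marginal_weight_def marginal_step_def marginals_def
      score_step_def score_def compare_def select_def update_step_def update_def type_loop_def)

section \<open>Correctness and cost of the program blocks\<close>

locale greedy_input =
  fixes P :: problem and \<mu> :: policy and \<Omega> :: supports
  assumes problem: "valid_problem P" and policy: "valid_policy P \<mu>"
    and card_support: "\<And>j t. j \<in> ctypes P \<Longrightarrow> t \<in> periods P \<Longrightarrow> card (set_pmf (\<mu> j t)) \<le> nprod P + 1"
    and pos: "1 \<le> nprod P" "1 \<le> ntype P" "1 \<le> horizon P"
    and enum: "enumerates P \<mu> \<Omega>"
begin

abbreviation "run \<equiv> runs P \<mu> \<Omega>"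
abbreviation "n \<equiv> nprod P"
abbreviation "m \<equiv> ntype P"
abbreviation "T \<equiv> horizon P"

text \<open>The length bound is \<open>2 * n\<close>, not \<open>n + 1\<close>, to keep all budgets
  monomials; this uses n \<ge> 1.\<close>

lemma support:
  assumes "j \<in> ctypes P" "t \<in> periods P"
  shows "distinct (\<Omega> j t)" "set (\<Omega> j t) = set_pmf (\<mu> j t)" "length (\<Omega> j t) \<le> 2 * n" "0 < length (\<Omega> j t)"
    "k < length (\<Omega> j t) \<Longrightarrow> \<Omega> j t ! k \<in> set_pmf (\<mu> j t)"
    "k < length (\<Omega> j t) \<Longrightarrow> \<Omega> j t ! k \<subseteq> products P"
proof -
  show *: "distinct (\<Omega> j t)" "set (\<Omega> j t) = set_pmf (\<mu> j t)"
    using enum assms by (auto simp: enumerates_def)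
  then show "length (\<Omega> j t) \<le> 2 * n"
    using card_support[OF assms] pos distinct_card[of "\<Omega> j t"] by simp
  show "0 < length (\<Omega> j t)" using * set_pmf_not_empty[of "\<mu> j t"] by force
  show k: "\<Omega> j t ! k \<in> set_pmf (\<mu> j t)" if "k < length (\<Omega> j t)"
    using * that nth_mem by blast
  show "\<Omega> j t ! k \<subseteq> products P" if "k < length (\<Omega> j t)"
    using k[OF that] policy assms by (auto simp: valid_policy_def)
qed

lemma mean_pick_support:
  assumes "j \<in> ctypes P" "t \<in> periods P"
  shows "mean_pick P \<mu> i j t = (\<Sum>k<length (\<Omega> j t). pmf (\<mu> j t) (\<Omega> j t ! k) * pick P i j (\<Omega> j t ! k))"
proof -
  have "mean_pick P \<mu> i j t = (\<Sum>S\<in>set (\<Omega> j t). pmf (\<mu> j t) S * pick P i j S)"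
    unfolding mean_pick_def support(2)[OF assms]
    by (rule sum.mono_neutral_right) (use policy assms in \<open>auto simp: valid_policy_def set_pmf_iff\<close>)
  also have "\<dots> = (\<Sum>k<length (\<Omega> j t). pmf (\<mu> j t) (\<Omega> j t ! k) * pick P i j (\<Omega> j t ! k))"
    using bij_betw_nth[OF support(1)[OF assms] refl refl] by (rule sum.reindex_bij_betw[symmetric])
  finally show ?thesis .
qed

lemma run_offer_type:
  assumes i: "ireg s ''i'' = i" "i \<in> products P" and j: "ireg s ''j'' = j" "j \<in> ctypes P"
    and t: "ireg s ''t'' = t" "t \<in> periods P"
  shows "run offer_type s (70 * n)
    (\<lambda>s'. rreg s' ''acc'' = rreg s ''acc'' + arrive P j t * mean_pick P \<mu> i j t)"
  unfolding offer_type_def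
\<comment> \<open>17 is the exact cost of \<open>offer_step\<close>, \<open>2 * n\<close> bounds the
  number of assortments, and 70 = 2 * (17 + 18). The budgets of the later loops arise in the same
  way.\<close>
proof (rule runs_For[where a = 0 and b = "length (\<Omega> j t)" and H = "2 * n" and N = 17 and
    Inv = "\<lambda>k s'. rreg s' ''acc'' = rreg s ''acc'' +
      (\<Sum>k<k. arrive P j t * (pmf (\<mu> j t) (\<Omega> j t ! k) * pick P i j (\<Omega> j t ! k)))", OF refl])
  fix k s1
  assume "k < length (\<Omega> j t)" "ireg s1 ''k'' = k"
    "rreg s1 ''acc'' = rreg s ''acc'' +
      (\<Sum>k<k. arrive P j t * (pmf (\<mu> j t) (\<Omega> j t ! k) * pick P i j (\<Omega> j t ! k)))"
    "same_outside (insert (IReg_loc ''k'') (writes offer_step)) s s1"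
  then show "run offer_step s1 17 (\<lambda>s2. rreg (s2\<lparr>ireg := (ireg s2)(''k'' := Suc k)\<rparr>) ''acc'' =
      rreg s ''acc'' +
      (\<Sum>k<Suc k. arrive P j t * (pmf (\<mu> j t) (\<Omega> j t ! k) * pick P i j (\<Omega> j t ! k))))"
    unfolding offer_step_def
    using i j t by (intro runs_SetRReg) (simp_all add: same_outside_def Let_def)
qed (use support[OF j(2) t(2)] i j t pos in
    \<open>auto simp: same_outside_def Let_def mean_pick_support sum_distrib_left\<close>)

lemma run_offer_cell:
  assumes i: "ireg s ''i'' = i" "i \<in> products P" and t: "ireg s ''t'' = t" "t \<in> periods P"
  shows "run offer_cell s (94 * (m * n))
    (\<lambda>s'. rarr s' ''phi'' = (rarr s ''phi'')(i := (rarr s ''phi'' i)(t := offer_prob P \<mu> i t)))"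
  unfolding offer_cell_def
proof (rule runs_Seq)
  show "run (SetRReg ''acc'' (RCon 0)) s 2 (\<lambda>s'. rreg s' ''acc'' = 0)"
    by (rule runs_SetRReg) auto
next
  fix s1 assume acc: "rreg s1 ''acc'' = 0"
    and s1: "same_outside (writes (SetRReg ''acc'' (RCon 0))) s s1"
  show "run (Seq (For ''j'' (ICon 1) (IAdd ITypes (ICon 1)) offer_type)
         (SetRArr ''phi'' (IReg ''i'') (IReg ''t'') (RReg ''acc''))) s1 (88 * (m * n) + 4)
     (\<lambda>s'. rarr s' ''phi'' = (rarr s ''phi'')(i := (rarr s ''phi'' i)(t := offer_prob P \<mu> i t)))"
  proof (rule runs_Seq)
    show "run (For ''j'' (ICon 1) (IAdd ITypes (ICon 1)) offer_type) s1 (88 * (m * n))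
      (\<lambda>s'. rreg s' ''acc'' = offer_prob P \<mu> i t)"
    proof (rule runs_For[where a = 1 and b = "Suc m" and H = m and N = "70 * n" and
        Inv = "\<lambda>j s'. rreg s' ''acc'' = (\<Sum>j\<in>{1..<j}. arrive P j t * mean_pick P \<mu> i j t)",
        OF refl])
      fix j s2
      assume j: "1 \<le> j" "j < Suc m" "ireg s2 ''j'' = j"
        and inv: "rreg s2 ''acc'' = (\<Sum>j\<in>{1..<j}. arrive P j t * mean_pick P \<mu> i j t)"
        and s2: "same_outside (insert (IReg_loc ''j'') (writes offer_type)) s1 s2"
      have "run offer_type s2 (70 * n)
        (\<lambda>s'. rreg s' ''acc'' = rreg s2 ''acc'' + arrive P j t * mean_pick P \<mu> i j t)"
        using i t j s1 s2 by (intro run_offer_type) (auto simp: same_outside_def ctypes_def)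
      then show "run offer_type s2 (70 * n)
        (\<lambda>s'. rreg (s'\<lparr>ireg := (ireg s')(''j'' := Suc j)\<rparr>) ''acc'' =
          (\<Sum>j\<in>{1..<Suc j}. arrive P j t * mean_pick P \<mu> i j t))"
        by (rule runs_weaken) (use j inv in \<open>auto simp: atLeastLessThanSuc\<close>)
    next
      show "m * (70 * n + 18) \<le> 88 * (m * n)" using pos by (simp add: algebra_simps)
    qed (use acc pos in \<open>auto simp: offer_prob_mean_pick ctypes_def atLeastLessThanSuc_atLeastAtMost\<close>)
  next
    fix s2 assume "rreg s2 ''acc'' = offer_prob P \<mu> i t"
      "same_outside (writes (For ''j'' (ICon 1) (IAdd ITypes (ICon 1)) offer_type)) s1 s2"
    then show "run (SetRArr ''phi'' (IReg ''i'') (IReg ''t'') (RReg ''acc'')) s2 4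
     (\<lambda>s'. rarr s' ''phi'' = (rarr s ''phi'')(i := (rarr s ''phi'' i)(t := offer_prob P \<mu> i t)))"
      using i t s1 by (intro runs_SetRArr) (auto simp: same_outside_def)
  qed simp
next
  \<comment> \<open>The assignments before and after the loop cost 2 and 4; since m n \<ge> 1 they
    raise the factor from 88 to 94.\<close>
  have "1 \<le> m * n" using pos by simp
  then show "2 + (88 * (m * n) + 4) \<le> 94 * (m * n)" by linarith
qed

lemma run_offer_period:
  assumes t: "ireg s ''t'' = t" "t \<in> periods P"
  shows "run offer_period s (112 * (m * n * n))
    (\<lambda>s'. \<forall>i\<in>products P. rarr s' ''phi'' i = (rarr s ''phi'' i)(t := offer_prob P \<mu> i t))"
  unfolding offer_period_def
proof (rule runs_For[where a = 1 and b = "Suc n" and H = n and N = "94 * (m * n)" and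
    Inv = "\<lambda>i s'. \<forall>i'. rarr s' ''phi'' i' =
      (if 1 \<le> i' \<and> i' < i then (rarr s ''phi'' i')(t := offer_prob P \<mu> i' t) else rarr s ''phi'' i')",
    OF refl])
  fix i s1
  assume i: "1 \<le> i" "i < Suc n" "ireg s1 ''i'' = i"
    and inv: "\<forall>i'. rarr s1 ''phi'' i' =
      (if 1 \<le> i' \<and> i' < i then (rarr s ''phi'' i')(t := offer_prob P \<mu> i' t) else rarr s ''phi'' i')"
    and s1: "same_outside (insert (IReg_loc ''i'') (writes offer_cell)) s s1"
  have "run offer_cell s1 (94 * (m * n))
      (\<lambda>s'. rarr s' ''phi'' = (rarr s1 ''phi'')(i := (rarr s1 ''phi'' i)(t := offer_prob P \<mu> i t)))"
    using i t s1 by (intro run_offer_cell) (auto simp: same_outside_def products_def)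
  then show "run offer_cell s1 (94 * (m * n)) (\<lambda>s'. \<forall>i'. rarr (s'\<lparr>ireg := (ireg s')(''i'' := Suc i)\<rparr>) ''phi'' i' =
      (if 1 \<le> i' \<and> i' < Suc i then (rarr s ''phi'' i')(t := offer_prob P \<mu> i' t) else rarr s ''phi'' i'))"
    by (rule runs_weaken) (use i inv in \<open>auto simp: less_Suc_eq\<close>)
next
  have "1 \<le> m * n" using pos by simp
  then have "n * (94 * (m * n) + 18) \<le> n * (112 * (m * n))" by (intro mult_left_mono) auto
  then show "n * (94 * (m * n) + 18) \<le> 112 * (m * n * n)" by (simp add: mult_ac)
qed (use pos in \<open>auto simp: products_def\<close>)

lemma run_offer_table:
  "run offer_table s (130 * (m * n * n * T))
    (\<lambda>s'. \<forall>i\<in>products P. \<forall>t\<in>periods P. rarr s' ''phi'' i t = offer_prob P \<mu> i t)"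
  unfolding offer_table_def
proof (rule runs_For[where a = 1 and b = "Suc T" and H = T and N = "112 * (m * n * n)" and
    Inv = "\<lambda>t s'. \<forall>i\<in>products P. \<forall>t'. 1 \<le> t' \<and> t' < t \<longrightarrow> rarr s' ''phi'' i t' = offer_prob P \<mu> i t'",
    OF refl])
  fix t and s1 :: state
  assume t: "1 \<le> t" "t < Suc T" "ireg s1 ''t'' = t"
    and inv: "\<forall>i\<in>products P. \<forall>t'. 1 \<le> t' \<and> t' < t \<longrightarrow> rarr s1 ''phi'' i t' = offer_prob P \<mu> i t'"
  have "run offer_period s1 (112 * (m * n * n))
    (\<lambda>s'. \<forall>i\<in>products P. rarr s' ''phi'' i = (rarr s1 ''phi'' i)(t := offer_prob P \<mu> i t))"
    using t by (intro run_offer_period) (auto simp: periods_def)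
  then show "run offer_period s1 (112 * (m * n * n))
    (\<lambda>s'. \<forall>i\<in>products P. \<forall>t'. 1 \<le> t' \<and> t' < Suc t \<longrightarrow>
       rarr (s'\<lparr>ireg := (ireg s')(''t'' := Suc t)\<rparr>) ''phi'' i t' = offer_prob P \<mu> i t')"
    by (rule runs_weaken) (use t inv in \<open>auto simp: less_Suc_eq\<close>)
next
  have "1 \<le> m * n * n" using pos by simp
  then have "T * (112 * (m * n * n) + 18) \<le> T * (130 * (m * n * n))" by (intro mult_left_mono) auto
  then show "T * (112 * (m * n * n) + 18) \<le> 130 * (m * n * n * T)" by (simp add: mult_ac)
qed (use pos in \<open>auto simp: periods_def\<close>)

lemma run_stock_row:
  assumes "ireg s ''i'' = i" "ireg s ''h'' = h" "h \<le> T"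
    and rows: "\<forall>h'<h. \<forall>c\<le>T. rarr s ''G'' h' c = stock_left (rarr s ''phi'' i) h' c"
  shows "run stock_row s (104 * T)
    (\<lambda>s'. \<forall>h'\<le>h. \<forall>c\<le>T. rarr s' ''G'' h' c = stock_left (rarr s ''phi'' i) h' c)"
  unfolding stock_row_def
\<comment> \<open>The T + 1 columns are bounded by 2 T. The most expensive path in a cell passes
  both tests, 4 each, and then the recursive assignment, 26.\<close>
proof (rule runs_For[where a = 0 and b = "Suc T" and H = "2 * T" and N = 34 and
    Inv = "\<lambda>c s'. (\<forall>h'<h. \<forall>c\<le>T. rarr s' ''G'' h' c = stock_left (rarr s ''phi'' i) h' c) \<and>
      (\<forall>c'<c. rarr s' ''G'' h c' = stock_left (rarr s ''phi'' i) h c')", OF refl])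
  fix c s1
  assume c: "c < Suc T" "ireg s1 ''c'' = c"
    and inv: "(\<forall>h'<h. \<forall>c\<le>T. rarr s1 ''G'' h' c = stock_left (rarr s ''phi'' i) h' c) \<and>
      (\<forall>c'<c. rarr s1 ''G'' h c' = stock_left (rarr s ''phi'' i) h c')"
    and s1: "same_outside (insert (IReg_loc ''c'') (writes stock_cell)) s s1"
  show "run stock_cell s1 34 (\<lambda>s'.
      (\<forall>h'<h. \<forall>c'\<le>T. rarr (s'\<lparr>ireg := (ireg s')(''c'' := Suc c)\<rparr>) ''G'' h' c' =
         stock_left (rarr s ''phi'' i) h' c') \<and>
      (\<forall>c'<Suc c. rarr (s'\<lparr>ireg := (ireg s')(''c'' := Suc c)\<rparr>) ''G'' h c' =
         stock_left (rarr s ''phi'' i) h c'))"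
    unfolding stock_cell_def
    using assms(1-3) c inv s1
    by (intro runs_Cond[where M = 30] runs_Cond[where M = 26] runs_SetRArr)
      (auto simp: same_outside_def less_Suc_eq stock_left_step)
next
  show "2 * T * (34 + 18) \<le> 104 * T" by simp
qed (use assms pos in \<open>auto simp: less_Suc_eq_le le_eq_less_or_eq\<close>)

lemma run_stock_table:
  assumes "ireg s ''i'' = i"
  shows "run stock_table s (244 * (T * T))
    (\<lambda>s'. \<forall>h\<le>T. \<forall>c\<le>T. rarr s' ''G'' h c = stock_left (rarr s ''phi'' i) h c)"
  unfolding stock_table_def
proof (rule runs_For[where a = 0 and b = "Suc T" and H = "2 * T" and N = "104 * T" and
    Inv = "\<lambda>h s'. \<forall>h'<h. \<forall>c\<le>T. rarr s' ''G'' h' c = stock_left (rarr s ''phi'' i) h' c", OF refl])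
  fix h s1
  assume h: "h < Suc T" "ireg s1 ''h'' = h"
    and inv: "\<forall>h'<h. \<forall>c\<le>T. rarr s1 ''G'' h' c = stock_left (rarr s ''phi'' i) h' c"
    and s1: "same_outside (insert (IReg_loc ''h'') (writes stock_row)) s s1"
  have "run stock_row s1 (104 * T)
    (\<lambda>s'. \<forall>h'\<le>h. \<forall>c\<le>T. rarr s' ''G'' h' c = stock_left (rarr s1 ''phi'' i) h' c)"
    using assms h inv s1 by (intro run_stock_row) (auto simp: same_outside_def)
  then show "run stock_row s1 (104 * T) (\<lambda>s'. \<forall>h'<Suc h. \<forall>c\<le>T.
      rarr (s'\<lparr>ireg := (ireg s')(''h'' := Suc h)\<rparr>) ''G'' h' c = stock_left (rarr s ''phi'' i) h' c)"
    by (rule runs_weaken) (use s1 in \<open>auto simp: less_Suc_eq_le same_outside_def\<close>)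
next
  show "2 * T * (104 * T + 18) \<le> 244 * (T * T)" using pos by (simp add: algebra_simps)
qed (use pos in auto)

lemma run_marginal_step:
  assumes i: "ireg s ''i'' = i" "i \<in> products P" and t: "ireg s ''t'' = t"
  shows "run marginal_step s (263 * (T * T))
    (\<lambda>s'. rarr s' ''phi'' = (rarr s ''phi'')(i := (rarr s ''phi'' i)(t := 0)) \<and>
       rarr s' ''w'' = (rarr s ''w'')(i := (rarr s ''w'' i)(0 :=
         revenue P i * stock_left ((rarr s ''phi'' i)(t := 0)) T (inventory P i))))"
  unfolding marginal_step_def
proof (rule runs_Seq)
  show "run (SetRArr ''phi'' (IReg ''i'') (IReg ''t'') (RCon 0)) s 4
      (\<lambda>s'. rarr s' ''phi'' = (rarr s ''phi'')(i := (rarr s ''phi'' i)(t := 0)))"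
    by (rule runs_SetRArr) (use i t in auto)
next
  fix s1
  assume phi: "rarr s1 ''phi'' = (rarr s ''phi'')(i := (rarr s ''phi'' i)(t := 0))"
    and s1: "same_outside (writes (SetRArr ''phi'' (IReg ''i'') (IReg ''t'') (RCon 0))) s s1"
  show "run (Seq stock_table marginal_weight) s1 (244 * (T * T) + 15)
    (\<lambda>s'. rarr s' ''phi'' = (rarr s ''phi'')(i := (rarr s ''phi'' i)(t := 0)) \<and>
       rarr s' ''w'' = (rarr s ''w'')(i := (rarr s ''w'' i)(0 :=
         revenue P i * stock_left ((rarr s ''phi'' i)(t := 0)) T (inventory P i))))"
  proof (rule runs_Seq[OF run_stock_table])
    show "ireg s1 ''i'' = i" using i s1 by (simp add: same_outside_def)
  next
    fix s2
    assume "\<forall>h\<le>T. \<forall>c\<le>T. rarr s2 ''G'' h c = stock_left (rarr s1 ''phi'' i) h c"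
      and "same_outside (writes stock_table) s1 s2"
    then show "run marginal_weight s2 15
      (\<lambda>s'. rarr s' ''phi'' = (rarr s ''phi'')(i := (rarr s ''phi'' i)(t := 0)) \<and>
       rarr s' ''w'' = (rarr s ''w'')(i := (rarr s ''w'' i)(0 :=
         revenue P i * stock_left ((rarr s ''phi'' i)(t := 0)) T (inventory P i))))"
      unfolding marginal_weight_def
      using i s1 phi
      by (intro runs_Cond[where M = 10] runs_SetRArr)
        (auto simp: same_outside_def Let_def stock_left_surplus not_less)
  qed simp
next
  have "1 \<le> T * T" using pos by simp
  then show "4 + (244 * (T * T) + 15) \<le> 263 * (T * T)" by linarith
qed

lemma run_marginals:
  assumes t: "ireg s ''t'' = t"
  shows "run marginals s (281 * (n * (T * T)))
    (\<lambda>s'. \<forall>i\<in>products P. rarr s' ''phi'' i = (rarr s ''phi'' i)(t := 0) \<and>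
       rarr s' ''w'' i 0 = revenue P i * stock_left ((rarr s ''phi'' i)(t := 0)) T (inventory P i))"
  unfolding marginals_def
\<comment> \<open>The second conjunct keeps the rows not yet visited intact, since each step reads
  its own row of \<open>phi\<close> before overwriting column t.\<close>
proof (rule runs_For[where a = 1 and b = "Suc n" and H = n and N = "263 * (T * T)" and
    Inv = "\<lambda>i s'. (\<forall>i'. 1 \<le> i' \<and> i' < i \<longrightarrow> rarr s' ''phi'' i' = (rarr s ''phi'' i')(t := 0) \<and>
       rarr s' ''w'' i' 0 = revenue P i' * stock_left ((rarr s ''phi'' i')(t := 0)) T (inventory P i')) \<and>
      (\<forall>i'\<ge>i. rarr s' ''phi'' i' = rarr s ''phi'' i')",
    OF refl])
  fix i s1
  assume i: "1 \<le> i" "i < Suc n" "ireg s1 ''i'' = i"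
    and inv: "(\<forall>i'. 1 \<le> i' \<and> i' < i \<longrightarrow> rarr s1 ''phi'' i' = (rarr s ''phi'' i')(t := 0) \<and>
       rarr s1 ''w'' i' 0 = revenue P i' * stock_left ((rarr s ''phi'' i')(t := 0)) T (inventory P i')) \<and>
      (\<forall>i'\<ge>i. rarr s1 ''phi'' i' = rarr s ''phi'' i')"
    and s1: "same_outside (insert (IReg_loc ''i'') (writes marginal_step)) s s1"
  have "run marginal_step s1 (263 * (T * T))
    (\<lambda>s'. rarr s' ''phi'' = (rarr s1 ''phi'')(i := (rarr s1 ''phi'' i)(t := 0)) \<and>
       rarr s' ''w'' = (rarr s1 ''w'')(i := (rarr s1 ''w'' i)(0 :=
         revenue P i * stock_left ((rarr s1 ''phi'' i)(t := 0)) T (inventory P i))))"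
    using i t s1 by (intro run_marginal_step) (auto simp: same_outside_def products_def)
  then show "run marginal_step s1 (263 * (T * T)) (\<lambda>s'.
      (\<forall>i'. 1 \<le> i' \<and> i' < Suc i \<longrightarrow>
         rarr (s'\<lparr>ireg := (ireg s')(''i'' := Suc i)\<rparr>) ''phi'' i' = (rarr s ''phi'' i')(t := 0) \<and>
         rarr (s'\<lparr>ireg := (ireg s')(''i'' := Suc i)\<rparr>) ''w'' i' 0 =
           revenue P i' * stock_left ((rarr s ''phi'' i')(t := 0)) T (inventory P i')) \<and>
      (\<forall>i'\<ge>Suc i. rarr (s'\<lparr>ireg := (ireg s')(''i'' := Suc i)\<rparr>) ''phi'' i' = rarr s ''phi'' i'))"
    by (rule runs_weaken) (use i inv in \<open>auto simp: less_Suc_eq\<close>)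
next
  have "1 \<le> T * T" using pos by simp
  then have "n * (263 * (T * T) + 18) \<le> n * (281 * (T * T))" by (intro mult_left_mono) auto
  then show "n * (263 * (T * T) + 18) \<le> 281 * (n * (T * T))" by (simp add: mult_ac)
qed (use pos in \<open>auto simp: products_def\<close>)

lemma run_score:
  assumes j: "ireg s ''j'' = j" "j \<in> ctypes P" and t: "ireg s ''t'' = t" "t \<in> periods P"
    and k: "ireg s ''k'' = k" "k < length (\<Omega> j t)"
  shows "run score s (32 * n)
    (\<lambda>s'. rreg s' ''val'' = (\<Sum>i\<in>products P. rarr s ''w'' i 0 * pick P i j (\<Omega> j t ! k)))"
  unfolding score_def
proof (rule runs_Seq)
  show "run (SetRReg ''val'' (RCon 0)) s 2 (\<lambda>s'. rreg s' ''val'' = 0)"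
    by (rule runs_SetRReg) auto
next
  fix s1
  assume val: "rreg s1 ''val'' = 0" and s1: "same_outside (writes (SetRReg ''val'' (RCon 0))) s s1"
  show "run (For ''i'' (ICon 1) (IAdd IProducts (ICon 1)) score_step) s1 (30 * n)
    (\<lambda>s'. rreg s' ''val'' = (\<Sum>i\<in>products P. rarr s ''w'' i 0 * pick P i j (\<Omega> j t ! k)))"
  proof (rule runs_For[where a = 1 and b = "Suc n" and H = n and N = 12 and
      Inv = "\<lambda>i s'. rreg s' ''val'' = (\<Sum>i\<in>{1..<i}. rarr s ''w'' i 0 * pick P i j (\<Omega> j t ! k))",
      OF refl])
    fix i s2
    assume "1 \<le> i" "i < Suc n" "ireg s2 ''i'' = i"
      "rreg s2 ''val'' = (\<Sum>i\<in>{1..<i}. rarr s ''w'' i 0 * pick P i j (\<Omega> j t ! k))"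
      "same_outside (insert (IReg_loc ''i'') (writes score_step)) s1 s2"
    then show "run score_step s2 12 (\<lambda>s'. rreg (s'\<lparr>ireg := (ireg s')(''i'' := Suc i)\<rparr>) ''val'' =
        (\<Sum>i\<in>{1..<Suc i}. rarr s ''w'' i 0 * pick P i j (\<Omega> j t ! k)))"
      unfolding score_step_def using j t k s1
      by (intro runs_SetRReg) (simp_all add: same_outside_def Let_def atLeastLessThanSuc products_def)
  qed (use val pos in \<open>auto simp: products_def atLeastLessThanSuc_atLeastAtMost\<close>)
qed (use pos in simp)

lemma run_select:
  assumes j: "ireg s ''j'' = j" "j \<in> ctypes P" and t: "ireg s ''t'' = t" "t \<in> periods P"
  shows "run select s (130 * (n * n))
    (\<lambda>s'. iarr s' ''out'' j t < length (\<Omega> j t) \<and>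
       (\<forall>k<length (\<Omega> j t). (\<Sum>i\<in>products P. rarr s ''w'' i 0 * pick P i j (\<Omega> j t ! k)) \<le>
          (\<Sum>i\<in>products P. rarr s ''w'' i 0 * pick P i j (\<Omega> j t ! iarr s' ''out'' j t))) \<and>
       (\<forall>j' t'. (j', t') \<noteq> (j, t) \<longrightarrow> iarr s' ''out'' j' t' = iarr s ''out'' j' t'))"
proof -
  define v where "v k = (\<Sum>i\<in>products P. rarr s ''w'' i 0 * pick P i j (\<Omega> j t ! k))" for k
  have "run select s (130 * (n * n))
    (\<lambda>s'. iarr s' ''out'' j t < length (\<Omega> j t) \<and>
       (\<forall>k<length (\<Omega> j t). v k \<le> v (iarr s' ''out'' j t)) \<and>
       (\<forall>j' t'. (j', t') \<noteq> (j, t) \<longrightarrow> iarr s' ''out'' j' t' = iarr s ''out'' j' t'))"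
    unfolding select_def
  \<comment> \<open>The guard \<open>0 < k\<close> is needed because \<open>out\<close> and
    \<open>best\<close> are arbitrary on entry. Entries of \<open>out\<close> at other pairs are
    tracked as they record earlier decisions.\<close>
  proof (rule runs_For[where a = 0 and b = "length (\<Omega> j t)" and H = "2 * n" and N = "47 * n" and
      Inv = "\<lambda>k s'. (0 < k \<longrightarrow> iarr s' ''out'' j t < k \<and> rreg s' ''best'' = v (iarr s' ''out'' j t) \<and>
          (\<forall>k'<k. v k' \<le> v (iarr s' ''out'' j t))) \<and>
        (\<forall>j' t'. (j', t') \<noteq> (j, t) \<longrightarrow> iarr s' ''out'' j' t' = iarr s ''out'' j' t')",
      OF refl])
    fix k s1
    assume k: "k < length (\<Omega> j t)" "ireg s1 ''k'' = k"
      and inv: "(0 < k \<longrightarrow> iarr s1 ''out'' j t < k \<and> rreg s1 ''best'' = v (iarr s1 ''out'' j t) \<and>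
          (\<forall>k'<k. v k' \<le> v (iarr s1 ''out'' j t))) \<and>
        (\<forall>j' t'. (j', t') \<noteq> (j, t) \<longrightarrow> iarr s1 ''out'' j' t' = iarr s ''out'' j' t')"
      and s1: "same_outside (insert (IReg_loc ''k'') (writes (Seq score compare))) s s1"
    have "run score s1 (32 * n)
        (\<lambda>s'. rreg s' ''val'' = (\<Sum>i\<in>products P. rarr s1 ''w'' i 0 * pick P i j (\<Omega> j t ! k)))"
      using j t k s1 by (intro run_score) (auto simp: same_outside_def)
    then have "run score s1 (32 * n) (\<lambda>s'. rreg s' ''val'' = v k)"
      by (rule runs_weaken) (use s1 in \<open>auto simp: same_outside_def v_def\<close>)
    then show "run (Seq score compare) s1 (47 * n) (\<lambda>s'.
        (0 < Suc k \<longrightarrow> iarr (s'\<lparr>ireg := (ireg s')(''k'' := Suc k)\<rparr>) ''out'' j t < Suc k \<and>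
          rreg (s'\<lparr>ireg := (ireg s')(''k'' := Suc k)\<rparr>) ''best'' =
            v (iarr (s'\<lparr>ireg := (ireg s')(''k'' := Suc k)\<rparr>) ''out'' j t) \<and>
          (\<forall>k'<Suc k. v k' \<le> v (iarr (s'\<lparr>ireg := (ireg s')(''k'' := Suc k)\<rparr>) ''out'' j t))) \<and>
        (\<forall>j' t'. (j', t') \<noteq> (j, t) \<longrightarrow>
          iarr (s'\<lparr>ireg := (ireg s')(''k'' := Suc k)\<rparr>) ''out'' j' t' = iarr s ''out'' j' t'))"
    proof (rule runs_Seq)
      fix s2 assume val: "rreg s2 ''val'' = v k" and s2: "same_outside (writes score) s1 s2"
      have regs: "ireg s2 ''k'' = k" "ireg s2 ''j'' = j" "ireg s2 ''t'' = t"
        "iarr s2 ''out'' = iarr s1 ''out''" "rreg s2 ''best'' = rreg s1 ''best''"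
        using k j t s1 s2 by (auto simp: same_outside_def)
      show "run compare s2 15 (\<lambda>s'.
        (0 < Suc k \<longrightarrow> iarr (s'\<lparr>ireg := (ireg s')(''k'' := Suc k)\<rparr>) ''out'' j t < Suc k \<and>
          rreg (s'\<lparr>ireg := (ireg s')(''k'' := Suc k)\<rparr>) ''best'' =
            v (iarr (s'\<lparr>ireg := (ireg s')(''k'' := Suc k)\<rparr>) ''out'' j t) \<and>
          (\<forall>k'<Suc k. v k' \<le> v (iarr (s'\<lparr>ireg := (ireg s')(''k'' := Suc k)\<rparr>) ''out'' j t))) \<and>
        (\<forall>j' t'. (j', t') \<noteq> (j, t) \<longrightarrow>
          iarr (s'\<lparr>ireg := (ireg s')(''k'' := Suc k)\<rparr>) ''out'' j' t' = iarr s ''out'' j' t'))"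
        unfolding compare_def
      proof (rule runs_Cond[where M = 6])
        assume "bval P \<mu> \<Omega> s2 (BAnd (BIndexLess (ICon 0) (IReg ''k''))
            (BNot (BRealLess (RReg ''best'') (RReg ''val''))))"
        then show "run Skip s2 6 (\<lambda>s'.
          (0 < Suc k \<longrightarrow> iarr (s'\<lparr>ireg := (ireg s')(''k'' := Suc k)\<rparr>) ''out'' j t < Suc k \<and>
            rreg (s'\<lparr>ireg := (ireg s')(''k'' := Suc k)\<rparr>) ''best'' =
              v (iarr (s'\<lparr>ireg := (ireg s')(''k'' := Suc k)\<rparr>) ''out'' j t) \<and>
            (\<forall>k'<Suc k. v k' \<le> v (iarr (s'\<lparr>ireg := (ireg s')(''k'' := Suc k)\<rparr>) ''out'' j t))) \<and>
          (\<forall>j' t'. (j', t') \<noteq> (j, t) \<longrightarrow>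
            iarr (s'\<lparr>ireg := (ireg s')(''k'' := Suc k)\<rparr>) ''out'' j' t' = iarr s ''out'' j' t'))"
          using inv val regs by (intro runs_Skip) (auto simp: less_Suc_eq not_less)
      next
        assume "\<not> bval P \<mu> \<Omega> s2 (BAnd (BIndexLess (ICon 0) (IReg ''k''))
            (BNot (BRealLess (RReg ''best'') (RReg ''val''))))"
        then have "k = 0 \<or> rreg s1 ''best'' < v k" using val regs by auto
        \<comment> \<open>For k > 0 the stored best value bounds all earlier scores and lies below
          \<open>v k\<close>; for k = 0 only k' = 0 remains.\<close>
        then have new: "v k' \<le> v k" if "k' < Suc k" for k'
          using inv that by (fastforce simp: less_Suc_eq)
        show "run (Seq (SetRReg ''best'' (RReg ''val''))
            (SetIArr ''out'' (IReg ''j'') (IReg ''t'') (IReg ''k''))) s2 6 (\<lambda>s'.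
          (0 < Suc k \<longrightarrow> iarr (s'\<lparr>ireg := (ireg s')(''k'' := Suc k)\<rparr>) ''out'' j t < Suc k \<and>
            rreg (s'\<lparr>ireg := (ireg s')(''k'' := Suc k)\<rparr>) ''best'' =
              v (iarr (s'\<lparr>ireg := (ireg s')(''k'' := Suc k)\<rparr>) ''out'' j t) \<and>
            (\<forall>k'<Suc k. v k' \<le> v (iarr (s'\<lparr>ireg := (ireg s')(''k'' := Suc k)\<rparr>) ''out'' j t))) \<and>
          (\<forall>j' t'. (j', t') \<noteq> (j, t) \<longrightarrow>
            iarr (s'\<lparr>ireg := (ireg s')(''k'' := Suc k)\<rparr>) ''out'' j' t' = iarr s ''out'' j' t'))"
        proof (rule runs_Seq[where M = 2 and M' = 4 and Q = "\<lambda>s'. rreg s' ''best'' = v k"])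
          show "run (SetRReg ''best'' (RReg ''val'')) s2 2 (\<lambda>s'. rreg s' ''best'' = v k)"
            by (rule runs_SetRReg) (use val in auto)
        qed (use inv regs new in \<open>auto simp: same_outside_def intro!: runs_SetIArr\<close>)
      qed simp
    qed (use pos in simp)
  next
    show "2 * n * (47 * n + 18) \<le> 130 * (n * n)" using pos by (simp add: algebra_simps)
  qed (use support[OF j(2) t(2)] j t pos in \<open>auto simp: same_outside_def Let_def\<close>)
  then show ?thesis unfolding v_def .
qed

lemma run_update:
  assumes j: "ireg s ''j'' = j" "j \<in> ctypes P" and t: "ireg s ''t'' = t" "t \<in> periods P"
    and k: "iarr s ''out'' j t = k" "k < length (\<Omega> j t)"
  shows "run update s (36 * n) (\<lambda>s'. \<forall>i\<in>products P. rarr s' ''phi'' i =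
      (rarr s ''phi'' i)(t := rarr s ''phi'' i t + arrive P j t * pick P i j (\<Omega> j t ! k)))"
  unfolding update_def
proof (rule runs_For[where a = 1 and b = "Suc n" and H = n and N = 18 and
    Inv = "\<lambda>i s'. (\<forall>i'. 1 \<le> i' \<and> i' < i \<longrightarrow> rarr s' ''phi'' i' =
      (rarr s ''phi'' i')(t := rarr s ''phi'' i' t + arrive P j t * pick P i' j (\<Omega> j t ! k))) \<and>
      (\<forall>i'\<ge>i. rarr s' ''phi'' i' = rarr s ''phi'' i')", OF refl])
  fix i s1
  assume "1 \<le> i" "i < Suc n" "ireg s1 ''i'' = i"
    "(\<forall>i'. 1 \<le> i' \<and> i' < i \<longrightarrow> rarr s1 ''phi'' i' =
      (rarr s ''phi'' i')(t := rarr s ''phi'' i' t + arrive P j t * pick P i' j (\<Omega> j t ! k))) \<and>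
      (\<forall>i'\<ge>i. rarr s1 ''phi'' i' = rarr s ''phi'' i')"
    "same_outside (insert (IReg_loc ''i'') (writes update_step)) s s1"
  then show "run update_step s1 18 (\<lambda>s'. (\<forall>i'. 1 \<le> i' \<and> i' < Suc i \<longrightarrow>
        rarr (s'\<lparr>ireg := (ireg s')(''i'' := Suc i)\<rparr>) ''phi'' i' =
      (rarr s ''phi'' i')(t := rarr s ''phi'' i' t + arrive P j t * pick P i' j (\<Omega> j t ! k))) \<and>
      (\<forall>i'\<ge>Suc i. rarr (s'\<lparr>ireg := (ireg s')(''i'' := Suc i)\<rparr>) ''phi'' i' = rarr s ''phi'' i'))"
    unfolding update_step_def using j t k
    by (intro runs_SetRArr) (auto simp: same_outside_def Let_def products_def less_Suc_eq)
qed (use pos in \<open>auto simp: products_def\<close>)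

end

text \<open>Revenue is a nondecreasing function of the score, with slope
  \<open>arrive P j t\<close>. If that slope is 0 all candidates tie, so a best score is sufficient
  for a maximizer but not necessary.\<close>

lemma is_arg_max_marginal_value:
  assumes V: "valid_problem P" "valid_policy P \<nu>" and j: "j \<in> ctypes P" and t: "t \<in> periods P"
    and S: "S \<in> set_pmf (\<nu> j t)"
    and best: "\<And>S'. S' \<in> set_pmf (\<nu> j t) \<Longrightarrow> (\<Sum>i\<in>products P. marginal_value P \<nu> t i * pick P i j S') \<le>
      (\<Sum>i\<in>products P. marginal_value P \<nu> t i * pick P i j S)"
  shows "is_arg_max (\<lambda>S. exp_revenue P (replace j t \<nu> S)) (\<lambda>S. S \<in> set_pmf (\<nu> j t)) S"
proof -
  have sub: "S' \<subseteq> products P" if "S' \<in> set_pmf (\<nu> j t)" for S'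
    using V(2) j t that by (auto simp: valid_policy_def)
  have "0 \<le> arrive P j t" using V(1) j t by (simp add: valid_problem_def)
  then show ?thesis
    using S best unfolding is_arg_max_linorder
    by (auto simp: exp_revenue_replace[OF V j t sub] intro!: mult_left_mono)
qed

section \<open>The program as a run of the greedy procedure\<close>

definition period_order :: "problem \<Rightarrow> nat \<Rightarrow> (nat \<times> nat) list" where
  "period_order P t = map (\<lambda>j. (j, t)) [1..<Suc (ntype P)]"

lemma greedy_period_order:
  "greedy P \<mu> \<eta> \<longleftrightarrow> greedy_steps P (concat (map (period_order P) [1..<Suc (horizon P)])) \<mu> \<eta>"
  by (simp add: greedy_def period_order_def[abs_def] del: upt_Suc)

context greedy_input
begin

text \<open>A version of \<open>outputs\<close> for a region D of treated pairs. Outside D the law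
  is still the original one, so \<open>\<Omega>\<close> enumerates the right support when a pair is
  reached.\<close>

definition decided :: "(nat \<Rightarrow> nat \<Rightarrow> bool) \<Rightarrow> state \<Rightarrow> policy \<Rightarrow> bool" where
  "decided D s \<nu> \<longleftrightarrow> (\<forall>j t.
     if j \<in> ctypes P \<and> t \<in> periods P \<and> D j t
     then iarr s ''out'' j t < length (\<Omega> j t) \<and> \<nu> j t = return_pmf (\<Omega> j t ! iarr s ''out'' j t)
     else \<nu> j t = \<mu> j t)"

text \<open>Column t of \<open>phi\<close> collects only the types below j and thus differs from
  \<open>offer_prob P \<nu>\<close>; an update then never has to subtract the old random assortment.
  The weights are those of the current \<open>\<nu>\<close>, although they are computed before the
  first type of the period is treated.\<close>

definition type_inv :: "nat \<Rightarrow> nat \<Rightarrow> state \<Rightarrow> policy \<Rightarrow> bool" where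
  "type_inv t j s \<nu> \<longleftrightarrow>
     greedy_steps P (concat (map (period_order P) [1..<t]) @ map (\<lambda>j. (j, t)) [1..<j]) \<mu> \<nu> \<and>
     decided (\<lambda>j' t'. t' < t \<or> t' = t \<and> j' < j) s \<nu> \<and>
     (\<forall>i\<in>products P. rarr s ''w'' i 0 = marginal_value P \<nu> t i \<and>
        (\<forall>t'\<in>periods P. rarr s ''phi'' i t' =
           (if t' = t then \<Sum>j'\<in>{1..<j}. arrive P j' t * mean_pick P \<nu> i j' t else offer_prob P \<nu> i t')))"

text \<open>Columns of later periods are included, with assortments still random there, because the
  weights of period t depend on the demand of all other periods.\<close>

definition period_inv :: "nat \<Rightarrow> state \<Rightarrow> policy \<Rightarrow> bool" where
  "period_inv t s \<nu> \<longleftrightarrow>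
     greedy_steps P (concat (map (period_order P) [1..<t])) \<mu> \<nu> \<and>
     decided (\<lambda>j' t'. t' < t) s \<nu> \<and>
     (\<forall>i\<in>products P. \<forall>t'\<in>periods P. rarr s ''phi'' i t' = offer_prob P \<nu> i t')"

text \<open>The pair (j, t) is undecided, so the best score over \<open>\<Omega> j t\<close> is a
  legal greedy step for \<open>\<nu>\<close>. The replacement alters offers in period t only; the
  weights ignore these, and column t gains exactly one summand.\<close>

lemma type_inv_Suc:
  assumes inv: "type_inv t j s \<nu>" and j: "1 \<le> j" "j \<in> ctypes P" and t: "t \<in> periods P"
    and k: "iarr s' ''out'' j t = k" "k < length (\<Omega> j t)"
    and best: "\<And>k'. k' < length (\<Omega> j t) \<Longrightarrow>
      (\<Sum>i\<in>products P. rarr s ''w'' i 0 * pick P i j (\<Omega> j t ! k')) \<le>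
      (\<Sum>i\<in>products P. rarr s ''w'' i 0 * pick P i j (\<Omega> j t ! k))"
    and out: "\<And>j' t'. (j', t') \<noteq> (j, t) \<Longrightarrow> iarr s' ''out'' j' t' = iarr s ''out'' j' t'"
    and w: "rarr s' ''w'' = rarr s ''w''"
    and phi: "\<And>i. i \<in> products P \<Longrightarrow> rarr s' ''phi'' i =
      (rarr s ''phi'' i)(t := rarr s ''phi'' i t + arrive P j t * pick P i j (\<Omega> j t ! k))"
  shows "type_inv t (Suc j) s' (replace j t \<nu> (\<Omega> j t ! k))"
proof -
  let ?S = "\<Omega> j t ! k"
  let ?\<nu> = "replace j t \<nu> ?S"
  have g: "greedy_steps P (concat (map (period_order P) [1..<t]) @ map (\<lambda>j. (j, t)) [1..<j]) \<mu> \<nu>"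
    and dec: "decided (\<lambda>j' t'. t' < t \<or> t' = t \<and> j' < j) s \<nu>"
    using inv by (auto simp: type_inv_def)
  have wv: "rarr s ''w'' i 0 = marginal_value P \<nu> t i" if "i \<in> products P" for i
    using inv that by (simp add: type_inv_def)
  have \<nu>: "\<nu> j t = \<mu> j t" using dec[unfolded decided_def, rule_format, of j t] by simp
  have supp: "set_pmf (\<nu> j t) = set (\<Omega> j t)" using support(2)[OF j(2) t] \<nu> by simp
  have S: "?S \<subseteq> products P" using support(6)[OF j(2) t k(2)] .
  have "is_arg_max (\<lambda>S. exp_revenue P (replace j t \<nu> S)) (\<lambda>S. S \<in> set_pmf (\<nu> j t)) ?S"
  proof (rule is_arg_max_marginal_value[OF problem valid_policy_greedy_steps[OF g policy] j(2) t])
    show "?S \<in> set_pmf (\<nu> j t)" using supp k by simp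
  next
    fix S' assume "S' \<in> set_pmf (\<nu> j t)"
    then obtain k' where "k' < length (\<Omega> j t)" "S' = \<Omega> j t ! k'"
      unfolding supp by (auto simp: in_set_conv_nth)
    then show "(\<Sum>i\<in>products P. marginal_value P \<nu> t i * pick P i j S') \<le>
      (\<Sum>i\<in>products P. marginal_value P \<nu> t i * pick P i j ?S)"
      using best[of k'] wv by simp
  qed
  then have "greedy_steps P ((concat (map (period_order P) [1..<t]) @ map (\<lambda>j. (j, t)) [1..<j]) @ [(j, t)]) \<mu> ?\<nu>"
    unfolding greedy_steps_append[of _ _ "[(j, t)]"] using g by (intro exI[of _ \<nu>]) auto
  then have steps: "greedy_steps P (concat (map (period_order P) [1..<t]) @ map (\<lambda>j. (j, t)) [1..<Suc j]) \<mu> ?\<nu>"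
    using j by (simp add: upt_Suc_append)
  have "decided (\<lambda>j' t'. t' < t \<or> t' = t \<and> j' < Suc j) s' ?\<nu>"
    unfolding decided_def
  proof (intro allI)
    fix j' t'
    show "if j' \<in> ctypes P \<and> t' \<in> periods P \<and> (t' < t \<or> t' = t \<and> j' < Suc j)
     then iarr s' ''out'' j' t' < length (\<Omega> j' t') \<and> ?\<nu> j' t' = return_pmf (\<Omega> j' t' ! iarr s' ''out'' j' t')
     else ?\<nu> j' t' = \<mu> j' t'"
    proof (cases "(j', t') = (j, t)")
      case True
      then show ?thesis using j t k by (simp add: replace_def)
    next
      case False
      then have "?\<nu> j' t' = \<nu> j' t'" by (auto simp: replace_def)
      moreover have "t' < t \<or> t' = t \<and> j' < Suc j \<longleftrightarrow> t' < t \<or> t' = t \<and> j' < j"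
        using False by auto
      ultimately show ?thesis using dec[unfolded decided_def, rule_format, of j' t'] out[OF False]
        by (auto split: if_splits)
    qed
  qed
  moreover have offer: "offer_prob P ?\<nu> i t' = offer_prob P \<nu> i t'" if "t' \<noteq> t" for i t'
  proof -
    have "?\<nu> j' t' = \<nu> j' t'" for j' using that by (simp add: replace_def)
    then show ?thesis by (simp add: offer_prob_def)
  qed
  \<comment> \<open>Zeroing the parameter of period t erases the only place where the two policies
    differ.\<close>
  moreover have "marginal_value P ?\<nu> t i = marginal_value P \<nu> t i" for i
  proof -
    have "(offer_prob P ?\<nu> i)(t := 0) = (offer_prob P \<nu> i)(t := 0)" using offer by auto
    then show ?thesis by (simp add: marginal_value_def)
  qed
  moreover have "(\<Sum>j'\<in>{1..<Suc j}. arrive P j' t * mean_pick P ?\<nu> i j' t) =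
      (\<Sum>j'\<in>{1..<j}. arrive P j' t * mean_pick P \<nu> i j' t) + arrive P j t * pick P i j ?S" for i
  proof -
    have "mean_pick P ?\<nu> i j t = pick P i j ?S"
      using S by (intro mean_pick_return) (simp_all add: replace_def)
    moreover have "(\<Sum>j'\<in>{1..<j}. arrive P j' t * mean_pick P ?\<nu> i j' t) =
        (\<Sum>j'\<in>{1..<j}. arrive P j' t * mean_pick P \<nu> i j' t)"
      by (intro sum.cong) (auto simp: mean_pick_def replace_def)
    ultimately show ?thesis using j by (simp add: atLeastLessThanSuc)
  qed
  ultimately show ?thesis
    using steps inv t unfolding type_inv_def by (simp add: phi w)
qed

lemma run_type_loop:
  assumes t: "ireg s ''t'' = t" "t \<in> periods P" and inv: "type_inv t 1 s \<nu>"
  shows "run type_loop s (184 * (m * (n * n))) (\<lambda>s'. \<exists>\<nu>. type_inv t (Suc m) s' \<nu>)"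
  unfolding type_loop_def
proof (rule runs_For[where a = 1 and b = "Suc m" and H = m and N = "166 * (n * n)" and
    Inv = "\<lambda>j s'. \<exists>\<nu>. type_inv t j s' \<nu>", OF refl])
  fix j s1
  assume j: "1 \<le> j" "j < Suc m" "ireg s1 ''j'' = j" and inv: "\<exists>\<nu>. type_inv t j s1 \<nu>"
    and s1: "same_outside (insert (IReg_loc ''j'') (writes (Seq select update))) s s1"
  obtain \<nu> where \<nu>: "type_inv t j s1 \<nu>" using inv by blast
  have jC: "j \<in> ctypes P" using j by (simp add: ctypes_def)
  have t1: "ireg s1 ''t'' = t" using t s1 by (simp add: same_outside_def)
  show "run (Seq select update) s1 (166 * (n * n))
     (\<lambda>s'. \<exists>\<nu>. type_inv t (Suc j) (s'\<lparr>ireg := (ireg s')(''j'' := Suc j)\<rparr>) \<nu>)"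
  proof (rule runs_Seq[OF run_select[OF j(3) jC t1 t(2)]])
    fix s2
    assume s2: "iarr s2 ''out'' j t < length (\<Omega> j t) \<and>
       (\<forall>k<length (\<Omega> j t). (\<Sum>i\<in>products P. rarr s1 ''w'' i 0 * pick P i j (\<Omega> j t ! k)) \<le>
          (\<Sum>i\<in>products P. rarr s1 ''w'' i 0 * pick P i j (\<Omega> j t ! iarr s2 ''out'' j t))) \<and>
       (\<forall>j' t'. (j', t') \<noteq> (j, t) \<longrightarrow> iarr s2 ''out'' j' t' = iarr s1 ''out'' j' t')"
      and same: "same_outside (writes select) s1 s2"
    have jt: "ireg s2 ''j'' = j" "ireg s2 ''t'' = t"
      using same j t1 by (auto simp: same_outside_def)
    show "run update s2 (36 * n)
      (\<lambda>s'. \<exists>\<nu>. type_inv t (Suc j) (s'\<lparr>ireg := (ireg s')(''j'' := Suc j)\<rparr>) \<nu>)"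
    proof (rule runs_weaken[OF run_update[OF jt(1) jC jt(2) t(2) refl conjunct1[OF s2]]])
      fix s3
      assume s3: "\<forall>i\<in>products P. rarr s3 ''phi'' i = (rarr s2 ''phi'' i)(t := rarr s2 ''phi'' i t +
          arrive P j t * pick P i j (\<Omega> j t ! iarr s2 ''out'' j t))"
        and same': "same_outside (writes update) s2 s3"
      have eq: "iarr s3 ''out'' = iarr s2 ''out''" "rarr s3 ''w'' = rarr s1 ''w''" "rarr s2 ''phi'' = rarr s1 ''phi''"
        using same same' by (auto simp: same_outside_def)
      show "\<exists>\<nu>. type_inv t (Suc j) (s3\<lparr>ireg := (ireg s3)(''j'' := Suc j)\<rparr>) \<nu>"
        by (rule exI[of _ "replace j t \<nu> (\<Omega> j t ! iarr s2 ''out'' j t)"],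
            rule type_inv_Suc[OF \<nu> j(1) jC t(2)])
          (use s2 s3 eq in auto)
    qed simp
  next
    have "n \<le> n * n" by simp
    then show "130 * (n * n) + 36 * n \<le> 166 * (n * n)" by linarith
  qed
next
  have "1 \<le> n * n" using pos by simp
  then have "m * (166 * (n * n) + 18) \<le> m * (184 * (n * n))" by (intro mult_left_mono) auto
  then show "m * (166 * (n * n) + 18) \<le> 184 * (m * (n * n))" by (simp add: mult_ac)
  show "\<exists>\<nu>. type_inv t 1 (s\<lparr>ireg := (ireg s)(''j'' := 1)\<rparr>) \<nu>"
    using inv by (auto simp: type_inv_def decided_def)
qed (use pos in auto)

lemma run_period_loop:
  assumes inv: "period_inv 1 s \<nu>"
  shows "run period_loop s (299 * (n * (T * T) * T) + 184 * (m * (n * n) * T))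
     (\<lambda>s'. \<exists>\<nu>. period_inv (Suc T) s' \<nu>)"
  unfolding period_loop_def
proof (rule runs_For[where a = 1 and b = "Suc T" and H = T and
    N = "281 * (n * (T * T)) + 184 * (m * (n * n))" and
    Inv = "\<lambda>t s'. \<exists>\<nu>. period_inv t s' \<nu>", OF refl])
  fix t s1
  assume t: "1 \<le> t" "t < Suc T" "ireg s1 ''t'' = t" and inv: "\<exists>\<nu>. period_inv t s1 \<nu>"
  obtain \<nu> where \<nu>: "period_inv t s1 \<nu>" using inv by blast
  have tT: "t \<in> periods P" using t by (simp add: periods_def)
  show "run (Seq marginals type_loop) s1 (281 * (n * (T * T)) + 184 * (m * (n * n)))
     (\<lambda>s'. \<exists>\<nu>. period_inv (Suc t) (s'\<lparr>ireg := (ireg s')(''t'' := Suc t)\<rparr>) \<nu>)"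
  proof (rule runs_Seq[OF run_marginals[OF t(3)]])
    fix s2
    assume s2: "\<forall>i\<in>products P. rarr s2 ''phi'' i = (rarr s1 ''phi'' i)(t := 0) \<and>
       rarr s2 ''w'' i 0 = revenue P i * stock_left ((rarr s1 ''phi'' i)(t := 0)) T (inventory P i)"
      and same: "same_outside (writes marginals) s1 s2"
    have t2: "ireg s2 ''t'' = t" using t same by (simp add: same_outside_def)
    \<comment> \<open>\<open>phi\<close> is known on the columns 1 to T only, which is all that
      \<open>stock_left\<close> with horizon T reads.\<close>
    have "rarr s2 ''w'' i 0 = marginal_value P \<nu> t i" if i: "i \<in> products P" for i
    proof -
      have "stock_left ((rarr s1 ''phi'' i)(t := 0)) T (inventory P i) =
          stock_left ((offer_prob P \<nu> i)(t := 0)) T (inventory P i)"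
        using \<nu> i by (intro stock_left_cong) (simp add: period_inv_def periods_def)
      then show ?thesis using s2 i by (simp add: marginal_value_def)
    qed
    moreover have "iarr s2 ''out'' = iarr s1 ''out''"
      using same by (simp add: same_outside_def)
    \<comment> \<open>No type lies below 1: nothing of period t is decided, and the zeroed column is
      the empty sum.\<close>
    ultimately have "type_inv t 1 s2 \<nu>"
      using \<nu> s2 tT unfolding type_inv_def period_inv_def
      by (auto simp: decided_def ctypes_def)
    then show "run type_loop s2 (184 * (m * (n * n)))
      (\<lambda>s'. \<exists>\<nu>. period_inv (Suc t) (s'\<lparr>ireg := (ireg s')(''t'' := Suc t)\<rparr>) \<nu>)"
    proof (rule runs_weaken[OF run_type_loop[OF t2 tT]])
      fix s3 assume "\<exists>\<nu>. type_inv t (Suc m) s3 \<nu>"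
      then obtain \<nu>' where \<nu>': "type_inv t (Suc m) s3 \<nu>'" by blast
      have "concat (map (period_order P) [1..<Suc t]) =
          concat (map (period_order P) [1..<t]) @ map (\<lambda>j. (j, t)) [1..<Suc m]"
        using t by (simp add: period_order_def upt_Suc_append del: upt_Suc)
      then have "greedy_steps P (concat (map (period_order P) [1..<Suc t])) \<mu> \<nu>'"
        using \<nu>' by (simp add: type_inv_def del: upt_Suc)
      moreover have "(j \<in> ctypes P \<and> t' \<in> periods P \<and> (t' < t \<or> t' = t \<and> j < Suc m)) \<longleftrightarrow>
          (j \<in> ctypes P \<and> t' \<in> periods P \<and> t' < Suc t)" for j t'
        by (auto simp: ctypes_def)
      then have "decided (\<lambda>j' t'. t' < Suc t) s3 \<nu>'"
        using \<nu>' by (simp add: type_inv_def decided_def)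
      \<comment> \<open>Once all m types are treated, the partial sums in column t are complete
        offer probabilities again.\<close>
      moreover have "rarr s3 ''phi'' i t' = offer_prob P \<nu>' i t'" if "i \<in> products P" "t' \<in> periods P" for i t'
        using \<nu>' that
        by (auto simp: type_inv_def offer_prob_mean_pick ctypes_def atLeastLessThanSuc_atLeastAtMost)
      ultimately show "\<exists>\<nu>. period_inv (Suc t) (s3\<lparr>ireg := (ireg s3)(''t'' := Suc t)\<rparr>) \<nu>"
        by (intro exI[of _ \<nu>']) (simp add: period_inv_def decided_def del: upt_Suc)
    qed simp
  qed simp
next
  \<comment> \<open>The loop overhead of 18 per period is charged to the dynamic programs: 281 + 18
    = 299.\<close>
  have "1 \<le> n * (T * T)" using pos by simp
  then have "T * (281 * (n * (T * T)) + 184 * (m * (n * n)) + 18) \<le>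
      T * (299 * (n * (T * T)) + 184 * (m * (n * n)))" by (intro mult_left_mono) auto
  then show "T * (281 * (n * (T * T)) + 184 * (m * (n * n)) + 18) \<le>
      299 * (n * (T * T) * T) + 184 * (m * (n * n) * T)" by (simp add: algebra_simps)
  show "\<exists>\<nu>. period_inv 1 (s\<lparr>ireg := (ireg s)(''t'' := 1)\<rparr>) \<nu>"
    using inv by (auto simp: period_inv_def decided_def)
qed (use pos in auto)

lemma run_greedy_program:
  "run greedy_program s (314 * ((m * n + T) * n * T\<^sup>2))
     (\<lambda>s'. \<exists>\<eta>. outputs P \<mu> \<Omega> s' \<eta> \<and> greedy P \<mu> \<eta>)"
  unfolding greedy_program_def
proof (rule runs_Seq[OF run_offer_table])
  fix s1 :: state
  assume "\<forall>i\<in>products P. \<forall>t\<in>periods P. rarr s1 ''phi'' i t = offer_prob P \<mu> i t"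
  then have "period_inv 1 s1 \<mu>" by (auto simp: period_inv_def decided_def periods_def)
  then show "run period_loop s1 (299 * (n * (T * T) * T) + 184 * (m * (n * n) * T))
     (\<lambda>s'. \<exists>\<eta>. outputs P \<mu> \<Omega> s' \<eta> \<and> greedy P \<mu> \<eta>)"
  proof (rule runs_weaken[OF run_period_loop])
    fix s' assume "\<exists>\<nu>. period_inv (Suc T) s' \<nu>"
    then obtain \<nu> where \<nu>: "period_inv (Suc T) s' \<nu>" by blast
    then have "greedy P \<mu> \<nu>" by (simp add: period_inv_def greedy_period_order del: upt_Suc)
    moreover have "(j \<in> ctypes P \<and> t \<in> periods P \<and> t < Suc T) \<longleftrightarrow> (j \<in> ctypes P \<and> t \<in> periods P)" for j t
      by (auto simp: periods_def)
    then have "outputs P \<mu> \<Omega> s' \<nu>" using \<nu> by (simp add: period_inv_def decided_def outputs_def)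
    ultimately show "\<exists>\<eta>. outputs P \<mu> \<Omega> s' \<eta> \<and> greedy P \<mu> \<eta>" by blast
  qed simp
next
  \<comment> \<open>314 = 130 + 184 adds up the terms in m n^2 T from the initial table and from
    selection and update; a factor T is given away to reach m n^2 T^2. The dynamic programs need 299
    of the 314 n T^3.\<close>
  have "m * n * n * T * 1 \<le> m * n * n * T * T" using pos by (intro mult_left_mono) auto
  then have "314 * (m * n * n * T) + 299 * (n * T * T * T) \<le>
      314 * (m * n * n * T * T) + 314 * (n * T * T * T)" by linarith
  then show "130 * (m * n * n * T) + (299 * (n * (T * T) * T) + 184 * (m * (n * n) * T)) \<le>
      314 * ((m * n + T) * n * T\<^sup>2)"
    by (simp add: power2_eq_square add_mult_distrib add_mult_distrib2 mult_ac)
qed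

end

theorem mainTheorem4:
  shows "(\<forall>P \<mu>.
            valid_problem P \<longrightarrow> valid_policy P \<mu> \<longrightarrow>
            (\<forall>j\<in>ctypes P. \<forall>t\<in>periods P. card (set_pmf (\<mu> j t)) \<le> nprod P + 1) \<longrightarrow>
            (\<exists>\<eta>. greedy P \<mu> \<eta>) \<and>
            (\<forall>\<eta>. greedy P \<mu> \<eta> \<longrightarrow>
               (\<forall>j\<in>ctypes P. \<forall>t\<in>periods P. \<exists>S\<in>set_pmf (\<mu> j t). \<eta> j t = return_pmf S) \<and>
               exp_revenue P \<mu> \<le> exp_revenue P \<eta>)) \<and>
         (\<exists>(prog :: com) (C :: nat). \<forall>P \<mu> \<Omega>.
            valid_problem P \<longrightarrow> valid_policy P \<mu> \<longrightarrow>
            (\<forall>j\<in>ctypes P. \<forall>t\<in>periods P. card (set_pmf (\<mu> j t)) \<le> nprod P + 1) \<longrightarrow>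
            1 \<le> nprod P \<longrightarrow> 1 \<le> ntype P \<longrightarrow> 1 \<le> horizon P \<longrightarrow>
            enumerates P \<mu> \<Omega> \<longrightarrow>
            (\<exists>k s \<eta>. exec P \<mu> \<Omega> prog init_state k s \<and>
               k \<le> C * ((ntype P * nprod P + horizon P) * nprod P * (horizon P)\<^sup>2) \<and>
               outputs P \<mu> \<Omega> s \<eta> \<and> greedy P \<mu> \<eta>))"
\<comment> \<open>Program and constant are instantiated before any input is fixed, so both are
  uniform in the sizes.\<close>
proof (intro conjI[OF _ exI[of _ greedy_program, OF exI[of _ 314]]] allI impI)
  fix P \<mu>
  assume "valid_problem P" "valid_policy P \<mu>"
  then show "(\<exists>\<eta>. greedy P \<mu> \<eta>) \<and>
            (\<forall>\<eta>. greedy P \<mu> \<eta> \<longrightarrow>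
               (\<forall>j\<in>ctypes P. \<forall>t\<in>periods P. \<exists>S\<in>set_pmf (\<mu> j t). \<eta> j t = return_pmf S) \<and>
               exp_revenue P \<mu> \<le> exp_revenue P \<eta>)"
    by (rule greedy_revenue)
next
  fix P \<mu> \<Omega>
  assume "valid_problem P" "valid_policy P \<mu>"
    "\<forall>j\<in>ctypes P. \<forall>t\<in>periods P. card (set_pmf (\<mu> j t)) \<le> nprod P + 1"
    "1 \<le> nprod P" "1 \<le> ntype P" "1 \<le> horizon P" "enumerates P \<mu> \<Omega>"
  then interpret greedy_input P \<mu> \<Omega> by unfold_locales auto
  show "\<exists>k s \<eta>. exec P \<mu> \<Omega> greedy_program init_state k s \<and>
               k \<le> 314 * ((ntype P * nprod P + horizon P) * nprod P * (horizon P)\<^sup>2) \<and>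
               outputs P \<mu> \<Omega> s \<eta> \<and> greedy P \<mu> \<eta>"
    using run_greedy_program[of init_state] unfolding runs_def by blast
qed

end
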